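(* For every $\tau\in\mathbb{H}^2$, $$\frac{\eta^5(2\tau)}{\eta^2(\tau)}=\sum_{n=1}^{\infty}(-1)^{n-1}n\left(\frac{n}{3}\right)\exp\left(\frac{2\pi i n^2\tau}{3}\right)$$ and $$\frac{\eta(\tau)\,\eta^6(6\tau)}{\eta^2(2\tau)\,\eta^3(3\tau)}=\sum_{n=1}^{\infty}\left(d_{1,3}^{*}(n)-d_{2,3}^{*}(n)\right)q^n,\qquad q=\exp(2\pi i\tau).$$
   Context: $\mathbb{H}^2=\{\tau\in\mathbb{C} : \Im\tau>0\}$ is the upper half plane. The Dedekind eta function is $\eta(\tau)=q^{1/24}\prod_{n=1}^{\infty}(1-q^n)$ with $q=\exp(2\pi i\tau)$ and $q^{1/24}=\exp(2\pi i\tau/24)$; $\eta^k(\cdot)$ denotes the $k$-th power. For $n\in\mathbb{N}$, $\left(\frac{n}{3}\right)$ equals $+1$ if $n\equiv 1\pmod 3$, $-1$ if $n\equiv -1\pmod 3$, and $0$ if $n\equiv 0\pmod 3$. For positive integers $j,k,n$, $d_{j,k}^{*}(n)$ denotes the number of positive divisors $d$ of $n$ such that $d\equiv j\pmod k$ and $n/d$ is odd. *)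

theory Defs
  imports "HOL-Analysis.Analysis" "HOL-Number_Theory.Number_Theory"
begin

definition q_param :: "complex \<Rightarrow> complex" where
  "q_param \<tau> = exp (2 * of_real pi * \<i> * \<tau>)"

definition dedekind_eta :: "complex \<Rightarrow> complex" where
  "dedekind_eta \<tau> = exp (2 * of_real pi * \<i> * \<tau> / 24) * (\<Prod>n. 1 - q_param \<tau> ^ Suc n)"

definition dstar :: "nat \<Rightarrow> nat \<Rightarrow> nat \<Rightarrow> nat" where
  "dstar j k n = card {d. d > 0 \<and> d dvd n \<and> [d = j] (mod k) \<and> odd (n div d)}"

text \<open>
  \<^const>\<open>prodinf\<close> has an unspecified value for divergent products, and division by zero is total;
  the next lemmas show that neither plays a role on the upper half plane.
\<close>

lemma norm_q_param_less_1:
  assumes "Im \<tau> > 0"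
  shows "norm (q_param \<tau>) < 1"
  using assms by (simp add: q_param_def)

lemma convergent_prod_dedekind_eta:
  assumes "Im \<tau> > 0"
  shows "convergent_prod (\<lambda>n. 1 - q_param \<tau> ^ Suc n)"
proof -
  have "summable (\<lambda>n. norm (q_param \<tau>) ^ Suc n)"
    using norm_q_param_less_1[OF assms] summable_geometric[of "norm (q_param \<tau>)"]
    by (subst summable_Suc_iff) auto
  hence "abs_convergent_prod (\<lambda>n. 1 - q_param \<tau> ^ Suc n)"
    by (subst abs_convergent_prod_conv_summable) (simp add: norm_power norm_mult)
  thus ?thesis
    by (rule abs_convergent_prod_imp_convergent_prod)
qed

lemma dedekind_eta_nonzero:
  assumes "Im \<tau> > 0"
  shows "dedekind_eta \<tau> \<noteq> 0"
proof -
  have "1 - q_param \<tau> ^ Suc n \<noteq> 0" for n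
  proof
    assume "1 - q_param \<tau> ^ Suc n = 0"
    hence "norm (q_param \<tau>) ^ Suc n = 1"
      by (metis eq_iff_diff_eq_0 norm_one norm_power)
    moreover have "norm (q_param \<tau>) ^ Suc n < 1"
      using norm_q_param_less_1[OF assms] by (intro power_Suc_less_one) (auto simp: q_param_def)
    ultimately show False by simp
  qed
  thus ?thesis
    using prodinf_nonzero[OF convergent_prod_dedekind_eta[OF assms]]
    by (simp add: dedekind_eta_def)
qed

text \<open>The symbol \<open>(n/3)\<close> is \<^term>\<open>Legendre (int n) 3\<close>, with the expected values:\<close>

lemma Legendre_3:
  "Legendre (int n) 3 = (if [n = 1] (mod 3) then 1 else if [n = 2] (mod 3) then -1 else 0)"
proof -
  have square: "y\<^sup>2 mod 3 \<noteq> 2" for y :: int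
  proof -
    have "y mod 3 \<in> {0, 1, 2}" by auto
    moreover have "y\<^sup>2 mod 3 = (y mod 3)\<^sup>2 mod 3" by (simp add: power_mod)
    ultimately show ?thesis by auto
  qed
  have n: "int n mod 3 = int (n mod 3)" by (simp add: zmod_int)
  consider "n mod 3 = 0" | "n mod 3 = 1" | "n mod 3 = 2" by linarith
  thus ?thesis
  proof cases
    case 1
    thus ?thesis using n by (simp add: Legendre_def cong_def)
  next
    case 2
    hence "QuadRes 3 (int n)"
      using n unfolding QuadRes_def cong_def by (intro exI[of _ 1]) simp
    thus ?thesis using 2 n by (simp add: Legendre_def cong_def)
  next
    case 3
    hence "\<not> QuadRes 3 (int n)"
      using n square by (simp add: QuadRes_def cong_def)
    thus ?thesis using 3 n by (simp add: Legendre_def cong_def)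
  qed
qed

end

theory Submission
  imports Defs
begin

text \<open>
  Put \<open>q = exp (2 \<pi> i \<tau>)\<close> and \<open>E\<^sub>k = (1 - q\<^sup>k) (1 - q\<^sup>2\<^sup>k) (1 - q\<^sup>3\<^sup>k) \<dots>\<close>, so that \<open>\<eta>(k \<tau>)\<close> is
  \<open>exp (2 \<pi> i k \<tau> / 24)\<close> times \<open>E\<^sub>k\<close>. After the powers of \<open>q\<close> are collected, both identities become
  identities between sums over all integers and products of the \<open>E\<^sub>k\<close>. The positive integers
  prime to 3 are the numbers \<open>\<bar>3k + 1\<bar>\<close> with \<open>k\<close> an integer, and the sign of \<open>3k + 1\<close> is the
  value of the quadratic character mod 3; this turns the one-sided series of the theorem into sums
  over the integers (\<open>has_sum_mod3_reindex\<close>).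

  The first identity says that the sum \<open>S\<close> of \<open>(-1)\<^sup>k (3k+1) q^(3k\<^sup>2+2k)\<close> is \<open>E\<^sub>2\<^sup>5 / E\<^sub>1\<^sup>2\<close>. It is a derivative
  of the quintuple product identity at a zero of the product, and it can be proved in the way that
  the quintuple product identity is proved by multiplying two theta series. Consider the double
  series of \<open>(m + 2n + 1) (-1)\<^sup>n q^(m\<^sup>2+2n\<^sup>2+2n)\<close>. Since the sum of \<open>(-1)\<^sup>n q^(2n\<^sup>2+2n)\<close> is 0, only the part of the weight
  that depends on \<open>n\<close> survives, and the double series is the theta series of the squares times
  \<open>2 E\<^sub>4\<^sup>3\<close> by Jacobi's formula for the cube of the Euler product (\<open>jacobi_cube\<close>). On the other
  hand, the double series can be summed according to \<open>m + 2n = 3k + r\<close> with \<open>r = 0, 1, 2\<close>: completing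
  the square separates the variables, the classes \<open>r = 0\<close> and \<open>r = 1\<close> both contribute \<open>S E\<^sub>4\<close> by
  the pentagonal number theorem, and the class \<open>r = 2\<close> contributes 0. Comparing the two values
  gives \<open>S\<close> (\<open>weight_three_halves_theta\<close>). The theta series that occur are specialisations of the
  Jacobi triple product, which is the limit of the q-binomial theorem.

  For the second identity, expanding geometric series turns the divisor sum into the Lambert
  series of \<open>(n/3) q\<^sup>n / (1 - q\<^sup>2\<^sup>n)\<close> (\<open>lambert_regroup\<close>). Folded out to the integers, this is the case
  \<open>z = q\<^sup>3\<close>, \<open>w = q\<^sup>2\<close>, base \<open>q\<^sup>6\<close>, of Kronecker's series, the sum of \<open>z\<^sup>j / (1 - w q\<^sup>j)\<close> over all integers \<open>j\<close>,
  which is a quotient of theta products (\<open>kronecker_lambert_series\<close>). That formula is in turn the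
  limit of the partial fraction expansion in \<open>w\<close> of a finite product of factors
  \<open>(1 - z w q\<^sup>i) / (1 - w q\<^sup>i)\<close>.

  In both limits dominated convergence applies because the coefficients of the finite
  identities are quotients of partial products of convergent infinite products, with no zero factors
  in the denominators, hence bounded (\<open>sum_tendsto_dominated\<close>).
\<close>

section \<open>Infinite q-Pochhammer symbols\<close>

text \<open>The q-Pochhammer symbol \<open>(a; q)\<^sub>n\<close> and its limit \<open>(a; q)\<^sub>\<infinity>\<close>.\<close>
definition qpoch_fin :: "complex \<Rightarrow> complex \<Rightarrow> nat \<Rightarrow> complex" where
  "qpoch_fin a q n = (\<Prod>i<n. 1 - a * q ^ i)"

definition qpoch :: "complex \<Rightarrow> complex \<Rightarrow> complex" where
  "qpoch a q = (\<Prod>i. 1 - a * q ^ i)"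

lemma convergent_prod_qpoch:
  fixes a q :: complex
  assumes "norm q < 1"
  shows "convergent_prod (\<lambda>i. 1 - a * q ^ i)"
proof -
  have "summable (\<lambda>i. norm a * norm q ^ i)"
    using assms by (intro summable_mult summable_geometric) auto
  hence "abs_convergent_prod (\<lambda>i. 1 - a * q ^ i)"
    by (subst abs_convergent_prod_conv_summable) (simp add: norm_power norm_mult)
  thus ?thesis
    by (rule abs_convergent_prod_imp_convergent_prod)
qed

lemma qpoch_fin_LIMSEQ:
  assumes "norm q < 1"
  shows "qpoch_fin a q \<longlonglongrightarrow> qpoch a q"
proof -
  have "(\<lambda>n. \<Prod>i\<le>n. 1 - a * q ^ i) \<longlonglongrightarrow> qpoch a q"
    unfolding qpoch_def using convergent_prod_qpoch[OF assms] by (rule convergent_prod_LIMSEQ)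
  thus ?thesis
    unfolding qpoch_fin_def by (subst (asm) LIMSEQ_lessThan_iff_atMost[symmetric])
qed

lemma qpoch_nonzero:
  assumes "norm q < 1" and "\<And>i. a * q ^ i \<noteq> 1"
  shows "qpoch a q \<noteq> 0"
  unfolding qpoch_def using convergent_prod_qpoch[OF assms(1)] assms(2)
  by (intro prodinf_nonzero) auto

lemma qpoch_nonzero':
  assumes "norm q < 1" and "norm a < 1"
  shows "qpoch a q \<noteq> 0"
proof (rule qpoch_nonzero[OF assms(1)])
  fix i
  have "norm (a * q ^ i) \<le> norm a * 1"
    unfolding norm_mult norm_power using assms(1) by (intro mult_left_mono power_le_one) auto
  thus "a * q ^ i \<noteq> 1" using assms(2) by auto
qed

lemma qpoch_fin_nonzero: "(\<And>i. a * q ^ i \<noteq> 1) \<Longrightarrow> qpoch_fin a q n \<noteq> 0"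
  unfolding qpoch_fin_def by auto

lemma qpoch_fin_bounded:
  assumes "norm q < 1"
  obtains C where "C > 0" "\<And>n. norm (qpoch_fin a q n) \<le> C"
  using convergent_imp_Bseq[OF convergentI[OF qpoch_fin_LIMSEQ[OF assms]], of a]
  unfolding Bseq_def by blast

lemma inverse_qpoch_fin_bounded:
  assumes "norm q < 1" and "norm a < 1"
  obtains C where "C > 0" "\<And>n. norm (inverse (qpoch_fin a q n)) \<le> C"
  using convergent_imp_Bseq[OF convergentI[OF tendsto_inverse[OF qpoch_fin_LIMSEQ qpoch_nonzero']], OF assms(1) assms]
  unfolding Bseq_def by blast

text \<open>
  The factors are sorted by the residue class of the exponent modulo \<open>k\<close>. This is the only way in
  which products to different bases are related below, apart from the difference of two squares.
\<close>
lemma qpoch_split: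
  assumes "norm q < 1" and "k > 0"
  shows "qpoch a q = (\<Prod>r<k. qpoch (a * q ^ r) (q ^ k))"
proof (rule LIMSEQ_unique)
  have "strict_mono (\<lambda>n. n * k)" using assms(2) by (auto intro: strict_monoI)
  from LIMSEQ_subseq_LIMSEQ[OF qpoch_fin_LIMSEQ[OF assms(1)] this]
  show "(\<lambda>n. qpoch_fin a q (n * k)) \<longlonglongrightarrow> qpoch a q" by (simp add: o_def)
  have "norm (q ^ k) < 1"
    using assms unfolding norm_power by (simp add: power_less_one_iff)
  hence "(\<lambda>n. \<Prod>r<k. qpoch_fin (a * q ^ r) (q ^ k) n) \<longlonglongrightarrow> (\<Prod>r<k. qpoch (a * q ^ r) (q ^ k))"
    by (intro tendsto_prod qpoch_fin_LIMSEQ)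
  also have "(\<lambda>n. \<Prod>r<k. qpoch_fin (a * q ^ r) (q ^ k) n) = (\<lambda>n. qpoch_fin a q (n * k))"
  proof
    fix n
    have "qpoch_fin a q (n * k) = (\<Prod>m<n. \<Prod>i = m*k..<m*k+k. 1 - a * q ^ i)"
      unfolding qpoch_fin_def by (rule prod.nat_group[symmetric])
    also have "\<dots> = (\<Prod>m<n. \<Prod>r<k. 1 - a * q ^ (m * k + r))"
    proof (rule prod.cong[OF refl])
      fix m
      show "(\<Prod>i = m*k..<m*k+k. 1 - a * q ^ i) = (\<Prod>r<k. 1 - a * q ^ (m * k + r))"
        by (rule prod.reindex_bij_witness[of _ "\<lambda>r. m * k + r" "\<lambda>i. i - m * k"]) auto
    qed
    also have "\<dots> = (\<Prod>r<k. \<Prod>m<n. 1 - a * q ^ (m * k + r))"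
      by (rule prod.swap)
    finally show "(\<Prod>r<k. qpoch_fin (a * q ^ r) (q ^ k) n) = qpoch_fin a q (n * k)"
      unfolding qpoch_fin_def by (simp add: power_add power_mult[symmetric] mult_ac)
  qed
  finally show "(\<lambda>n. qpoch_fin a q (n * k)) \<longlonglongrightarrow> (\<Prod>r<k. qpoch (a * q ^ r) (q ^ k))" .
qed

lemma qpoch_mult_minus:
  assumes "norm q < 1"
  shows "qpoch a q * qpoch (-a) q = qpoch (a\<^sup>2) (q\<^sup>2)"
proof (rule LIMSEQ_unique)
  show "(\<lambda>n. qpoch_fin a q n * qpoch_fin (-a) q n) \<longlonglongrightarrow> qpoch a q * qpoch (-a) q"
    by (intro tendsto_mult qpoch_fin_LIMSEQ assms)
  have "norm (q\<^sup>2) < 1"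
    using assms unfolding norm_power by (simp add: power_less_one_iff)
  hence "qpoch_fin (a\<^sup>2) (q\<^sup>2) \<longlonglongrightarrow> qpoch (a\<^sup>2) (q\<^sup>2)"
    by (rule qpoch_fin_LIMSEQ)
  also have "qpoch_fin (a\<^sup>2) (q\<^sup>2) = (\<lambda>n. qpoch_fin a q n * qpoch_fin (-a) q n)"
    unfolding qpoch_fin_def
    by (auto simp: prod.distrib[symmetric] fun_eq_iff power2_eq_square power_mult_distrib algebra_simps
          intro!: prod.cong)
  finally show "(\<lambda>n. qpoch_fin a q n * qpoch_fin (-a) q n) \<longlonglongrightarrow> qpoch (a\<^sup>2) (q\<^sup>2)" .
qed

lemma norm_power_less_1:
  fixes q :: complex
  assumes "norm q < 1" "k > 0"
  shows "norm (q ^ k) < 1"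
  using assms by (simp add: norm_power power_less_one_iff)

lemma qpoch_self_nonzero:
  assumes "norm q < 1" "k > 0"
  shows "qpoch (q ^ k) (q ^ k) \<noteq> 0"
  using norm_power_less_1[OF assms] by (intro qpoch_nonzero') auto

lemma qpoch_1_eq_0:
  assumes "norm q < 1"
  shows "qpoch 1 q = 0"
proof -
  have "(\<lambda>n. qpoch_fin 1 q (Suc n)) \<longlonglongrightarrow> qpoch 1 q"
    by (rule LIMSEQ_Suc[OF qpoch_fin_LIMSEQ[OF assms]])
  moreover have "qpoch_fin 1 q (Suc n) = 0" for n
    by (simp add: qpoch_fin_def prod.lessThan_Suc_shift del: prod.lessThan_Suc)
  ultimately have "(\<lambda>_::nat. 0) \<longlonglongrightarrow> qpoch 1 q" by simp
  thus ?thesis by (simp add: LIMSEQ_const_iff)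
qed

lemma qpoch_odd:
  assumes q: "norm q < 1"
  shows "qpoch q (q\<^sup>2) = qpoch q q / qpoch (q\<^sup>2) (q\<^sup>2)"
proof -
  have "qpoch q q = qpoch q (q\<^sup>2) * qpoch (q\<^sup>2) (q\<^sup>2)"
    using qpoch_split[OF q, of 2 q] by (simp add: numeral_2_eq_2 power2_eq_square)
  thus ?thesis using qpoch_self_nonzero[OF q, of 2] by simp
qed

lemma qpoch_mod3:
  assumes q: "norm q < 1"
  shows "qpoch a q = qpoch a (q ^ 3) * qpoch (a * q) (q ^ 3) * qpoch (a * q\<^sup>2) (q ^ 3)"
  using qpoch_split[OF q, of 3 a] by (simp add: numeral_3_eq_3 numeral_2_eq_2)

section \<open>Sums over the integers\<close>

lemma power_int_neq_1:
  fixes q :: complex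
  assumes "norm q < 1" "i \<noteq> 0"
  shows "q powi i \<noteq> 1"
proof
  assume "q powi i = 1"
  hence "q ^ nat \<bar>i\<bar> = 1" by (cases "i \<ge> 0") (auto simp: power_int_def power_inverse)
  moreover have "norm (q ^ nat \<bar>i\<bar>) < 1"
    using assms unfolding norm_power by (simp add: power_less_one_iff)
  ultimately show False by simp
qed

text \<open>
  Tannery's theorem with a range of summation that depends on \<open>N\<close>: dominated convergence for the
  counting measure.
\<close>
lemma sum_tendsto_dominated:
  fixes f :: "nat \<Rightarrow> 'a \<Rightarrow> complex"
  assumes fin: "\<And>N. finite (S N)"
    and lim: "\<And>j. (\<lambda>N. if j \<in> S N then f N j else 0) \<longlonglongrightarrow> g j"
    and bound: "\<And>N j. j \<in> S N \<Longrightarrow> norm (f N j) \<le> h j"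
    and h: "h summable_on UNIV" and h_nonneg: "\<And>j. h j \<ge> 0"
  shows "g summable_on UNIV" and "(\<lambda>N. \<Sum>j\<in>S N. f N j) \<longlonglongrightarrow> infsum g UNIV"
proof -
  let ?F = "\<lambda>N j. if j \<in> S N then f N j else 0"
  have h': "integrable (count_space UNIV) h"
    using abs_summable_equivalent[of h UNIV] summable_on_iff_abs_summable_on_real[of h UNIV] h
    unfolding abs_summable_on_def by blast
  have bound': "norm (?F N j) \<le> h j" for N j using bound h_nonneg by auto
  have g_int: "integrable (count_space UNIV) g"
    by (rule integrable_dominated_convergence[of g "count_space UNIV" ?F h]) (use h' lim bound' in auto)
  hence g: "(\<lambda>j. norm (g j)) summable_on UNIV"
    using abs_summable_equivalent[of g UNIV] unfolding abs_summable_on_def by blast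
  thus "g summable_on UNIV" by (rule abs_summable_summable)
  have "(\<lambda>N. integral\<^sup>L (count_space UNIV) (?F N)) \<longlonglongrightarrow> integral\<^sup>L (count_space UNIV) g"
    by (rule integral_dominated_convergence[of g "count_space UNIV" ?F h]) (use h' lim bound' in auto)
  also have "integral\<^sup>L (count_space UNIV) g = infsum g UNIV"
    using infsetsum_infsum[of g UNIV] g_int unfolding infsetsum_def abs_summable_on_def by blast
  also have "(\<lambda>N. integral\<^sup>L (count_space UNIV) (?F N)) = (\<lambda>N. \<Sum>j\<in>S N. f N j)"
  proof
    fix N
    have "integral\<^sup>L (count_space UNIV) (?F N) = (\<Sum>j\<in>S N. ?F N j)"
      by (rule lebesgue_integral_count_space_finite_support[THEN trans])
         (use fin[of N] in \<open>auto intro!: sum.mono_neutral_left intro: finite_subset[of _ "S N"] split: if_splits\<close>)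
    thus "integral\<^sup>L (count_space UNIV) (?F N) = (\<Sum>j\<in>S N. f N j)" by simp
  qed
  finally show "(\<lambda>N. \<Sum>j\<in>S N. f N j) \<longlonglongrightarrow> infsum g UNIV" .
qed

lemma summable_on_int:
  fixes f :: "int \<Rightarrow> complex"
  assumes "summable (\<lambda>n. norm (f (int n)))" and "summable (\<lambda>n. norm (f (- int n)))"
  shows "f summable_on UNIV"
proof -
  have 1: "(\<lambda>n. f (int n)) summable_on UNIV" and 2: "(\<lambda>n. f (- int n)) summable_on UNIV"
    by (rule norm_summable_imp_summable_on, rule assms)+
  have "f summable_on range int"
    using 1 by (subst summable_on_reindex) (auto simp: o_def inj_on_def)
  moreover have "f summable_on range (\<lambda>n. - int n)"
    using 2 by (subst summable_on_reindex) (auto simp: o_def inj_on_def)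
  ultimately have "f summable_on (range int \<union> range (\<lambda>n. - int n))"
    by (rule summable_on_union)
  also have "range int \<union> range (\<lambda>n. - int n) = UNIV"
  proof -
    have "x \<in> range int \<union> range (\<lambda>n. - int n)" for x :: int
      by (cases x rule: int_cases2) auto
    thus ?thesis by auto
  qed
  finally show ?thesis .
qed

text \<open>
  The square root test: \<open>q^(n\<^sup>2) z\<^sup>n = (q\<^sup>n z)\<^sup>n\<close>, and \<open>q\<^sup>n z\<close> tends to 0. The linear factor allows for
  the theta series of weight 3/2.
\<close>
lemma summable_on_theta:
  fixes q z a b :: complex
  assumes q: "norm q < 1" and z: "z \<noteq> 0"
  shows "(\<lambda>n::int. (a + b * of_int n) * (q powi n\<^sup>2 * z powi n)) summable_on UNIV"
proof -
  have main: "summable (\<lambda>n. norm ((a + c * of_nat n) * (q ^ n\<^sup>2 * y ^ n)))" for c y :: complex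
  proof -
    have "summable (\<lambda>n. of_nat (Suc n) * (1/2::real) ^ n)"
      using geometric_deriv_sums[of "1/2::real"] by (auto simp: sums_iff)
    hence "summable (\<lambda>n. norm a * (1/2) ^ n + norm c * (real (Suc n) * (1/2) ^ n))"
      by (intro summable_add summable_mult summable_geometric) auto
    moreover have "(\<lambda>n. norm q ^ n * norm y) \<longlonglongrightarrow> 0 * norm y"
      using q by (intro tendsto_intros LIMSEQ_power_zero) auto
    hence "eventually (\<lambda>n. norm q ^ n * norm y < 1/2) sequentially"
      by (rule order_tendstoD) auto
    hence "eventually (\<lambda>n. norm (norm ((a + c * of_nat n) * (q ^ n\<^sup>2 * y ^ n)))
              \<le> norm a * (1/2) ^ n + norm c * (real (Suc n) * (1/2) ^ n)) sequentially"
    proof eventually_elim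
      case (elim n)
      have "norm (a + c * of_nat n) \<le> norm a + norm c * real n"
        by (rule norm_triangle_le) (simp add: norm_mult)
      also have "\<dots> \<le> norm a + norm c * real (Suc n)"
        by (intro add_left_mono mult_left_mono) auto
      finally have "norm (a + c * of_nat n) \<le> norm a + norm c * real (Suc n)" .
      moreover have "norm (q ^ n\<^sup>2 * y ^ n) = (norm q ^ n * norm y) ^ n"
        by (simp add: norm_mult norm_power power_mult_distrib power2_eq_square power_mult)
      hence "norm (q ^ n\<^sup>2 * y ^ n) \<le> (1/2) ^ n"
        using elim by (metis less_imp_le norm_ge_zero norm_mult norm_power power_mono)
      ultimately have "norm (a + c * of_nat n) * norm (q ^ n\<^sup>2 * y ^ n)
                         \<le> (norm a + norm c * real (Suc n)) * (1/2) ^ n"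
        by (rule mult_mono) auto
      thus ?case unfolding norm_mult by (simp add: algebra_simps norm_mult)
    qed
    ultimately show ?thesis by (rule summable_comparison_test_ev[rotated])
  qed
  have square: "q powi (int n)\<^sup>2 = q ^ n\<^sup>2" for n
    by (metis of_nat_power power_int_of_nat)
  show ?thesis
  proof (rule summable_on_int)
    show "summable (\<lambda>n. norm ((a + b * of_int (int n)) * (q powi (int n)\<^sup>2 * z powi (int n))))"
      using main[of b z] by (simp add: square)
    show "summable (\<lambda>n. norm ((a + b * of_int (- int n)) * (q powi (- int n)\<^sup>2 * z powi (- int n))))"
      using main[of "-b" "inverse z"] by (simp add: square power_int_minus power_inverse)
  qed
qed

lemma has_sum_times:
  fixes f g :: "_ \<Rightarrow> complex"
  assumes f: "(f has_sum a) A" and g: "(g has_sum b) B"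
  shows "((\<lambda>(x, y). f x * g y) has_sum a * b) (A \<times> B)"
proof (rule has_sum_SigmaI)
  show "((\<lambda>y. case (x, y) of (x, y) \<Rightarrow> f x * g y) has_sum f x * b) B" for x
    using has_sum_cmult_right[OF g] by simp
  show "((\<lambda>x. f x * b) has_sum a * b) A"
    using has_sum_cmult_left[OF f] .
  have f': "(\<lambda>x. norm (f x)) summable_on A" and g': "(\<lambda>y. norm (g y)) summable_on B"
    using has_sum_imp_summable[OF f] has_sum_imp_summable[OF g]
    by (simp_all add: summable_on_iff_abs_summable_on_complex)
  have "(\<lambda>z. norm ((\<lambda>(x, y). f x * g y) z)) summable_on (A \<times> B)"
  proof (rule iffD2[OF Infinite_Sum.abs_summable_on_Sigma_iff], intro conjI ballI)
    show "(\<lambda>y. norm (case (x, y) of (x, y) \<Rightarrow> f x * g y)) summable_on B" for x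
      using g' by (simp add: norm_mult summable_on_cmult_right)
    show "(\<lambda>x. norm (\<Sum>\<^sub>\<infinity>y\<in>B. norm (case (x, y) of (x, y) \<Rightarrow> f x * g y))) summable_on A"
      using f' by (simp add: norm_mult abs_mult infsum_cmult_right' summable_on_cmult_left)
  qed
  thus "(\<lambda>(x, y). f x * g y) summable_on (A \<times> B)"
    by (rule abs_summable_summable)
qed

lemma tendsto_comp_nat_offset:
  fixes f :: "nat \<Rightarrow> 'a :: topological_space"
  assumes "f \<longlonglongrightarrow> L"
  shows "(\<lambda>N. f (nat (int N + c))) \<longlonglongrightarrow> L"
proof -
  have "filterlim (\<lambda>N. nat (int N + c)) at_top sequentially"
    unfolding filterlim_at_top
  proof safe
    fix Z
    show "eventually (\<lambda>N. Z \<le> nat (int N + c)) sequentially"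
      using eventually_ge_at_top[of "nat (int Z - c)"] by eventually_elim linarith
  qed
  thus ?thesis by (rule filterlim_compose[OF assms])
qed

section \<open>Partial fractions and the Kronecker series\<close>

text \<open>
  Each factor has value \<open>z\<close> at \<open>w = \<infinity>\<close>, which explains the constant term, and a simple pole at
  \<open>w = 1 / a\<^sub>j\<close>; the coefficients are the values of the remaining factors there. In the inductive step
  the coefficient of the new pole \<open>1 / a\<^sub>k\<close> comes out as a partial fraction sum again, namely the
  expansion of the old product evaluated at \<open>w = 1 / a\<^sub>k\<close>, so the induction hypothesis is used for two
  values of \<open>w\<close>.
\<close>
lemma partial_fractions_prod:
  fixes a :: "'i \<Rightarrow> 'a :: field"
  assumes "finite S" "inj_on a S" "\<And>i. i \<in> S \<Longrightarrow> a i \<noteq> 0" "\<And>i. i \<in> S \<Longrightarrow> w * a i \<noteq> 1"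
  shows "(\<Prod>i\<in>S. (1 - z * w * a i) / (1 - w * a i)) =
           z ^ card S + (\<Sum>j\<in>S. (1 - z) * (\<Prod>i\<in>S-{j}. (1 - z * (a i / a j)) / (1 - a i / a j)) / (1 - w * a j))"
  using assms
proof (induction S arbitrary: w rule: finite_induct)
  case empty
  show ?case by simp
next
  case (insert k S)
  define C where "C j = (1 - z) * (\<Prod>i\<in>S-{j}. (1 - z * (a i / a j)) / (1 - a i / a j))" for j
  let ?b = "a k"
  have inj: "inj_on a S" and ne: "\<And>i. i \<in> S \<Longrightarrow> a i \<noteq> ?b" and b: "?b \<noteq> 0" "w * ?b \<noteq> 1"
    using insert.prems insert.hyps by (auto simp: inj_on_def)
  have IH: "(\<Prod>i\<in>S. (1 - z * u * a i) / (1 - u * a i)) = z ^ card S + (\<Sum>j\<in>S. C j / (1 - u * a j))"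
    if "\<And>i. i \<in> S \<Longrightarrow> u * a i \<noteq> 1" for u
    unfolding C_def using insert.prems inj that by (intro insert.IH) auto
  \<comment> \<open>the induction hypothesis at the new pole\<close>
  have residue: "(\<Prod>i\<in>S. (1 - z * (a i / ?b)) / (1 - a i / ?b)) = z ^ card S + (\<Sum>j\<in>S. C j / (1 - a j / ?b))"
    using IH[of "1 / ?b"] ne b by (simp add: divide_simps)
  have pair: "(1 - z * w * ?b) / ((1 - w * x) * (1 - w * ?b)) =
      (1 - z * (?b / x)) / (1 - ?b / x) / (1 - w * x) + (1 - z) / (1 - x / ?b) / (1 - w * ?b)"
    if "x \<noteq> ?b" "x \<noteq> 0" "w * x \<noteq> 1" for x
    using that b by (simp add: divide_simps) (simp add: algebra_simps)
  have "(\<Prod>i\<in>insert k S. (1 - z * w * a i) / (1 - w * a i))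
      = (z ^ card S + (\<Sum>j\<in>S. C j / (1 - w * a j))) * ((1 - z * w * ?b) / (1 - w * ?b))"
    using IH[of w] insert.prems insert.hyps by simp
  also have "\<dots> = z ^ card S * ((1 - z * w * ?b) / (1 - w * ?b))
      + (\<Sum>j\<in>S. C j * ((1 - z * w * ?b) / ((1 - w * a j) * (1 - w * ?b))))"
    by (subst distrib_right, subst sum_distrib_right)
       (simp only: times_divide_eq_left times_divide_eq_right divide_divide_eq_left)
  also have "(1 - z * w * ?b) / (1 - w * ?b) = z + (1 - z) / (1 - w * ?b)"
    using b by (simp add: divide_simps) (simp add: algebra_simps)
  also have "(\<Sum>j\<in>S. C j * ((1 - z * w * ?b) / ((1 - w * a j) * (1 - w * ?b)))) =
      (\<Sum>j\<in>S. C j * ((1 - z * (?b / a j)) / (1 - ?b / a j)) / (1 - w * a j))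
      + (1 - z) / (1 - w * ?b) * (\<Sum>j\<in>S. C j / (1 - a j / ?b))"
    unfolding sum_distrib_left sum.distrib[symmetric]
    by (intro sum.cong refl, subst pair)
       (use insert.prems ne in \<open>auto simp: algebra_simps\<close>)
  also have "z ^ card S * (z + (1 - z) / (1 - w * ?b)) +
      ((\<Sum>j\<in>S. C j * ((1 - z * (?b / a j)) / (1 - ?b / a j)) / (1 - w * a j))
      + (1 - z) / (1 - w * ?b) * (\<Sum>j\<in>S. C j / (1 - a j / ?b)))
     = z ^ Suc (card S) + ((1 - z) * (z ^ card S + (\<Sum>j\<in>S. C j / (1 - a j / ?b))) / (1 - w * ?b)
       + (\<Sum>j\<in>S. C j * ((1 - z * (?b / a j)) / (1 - ?b / a j)) / (1 - w * a j)))"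
    by (simp add: distrib_left add_divide_distrib mult_ac add_ac)
  also have "(\<Sum>j\<in>S. C j * ((1 - z * (?b / a j)) / (1 - ?b / a j)) / (1 - w * a j)) =
      (\<Sum>j\<in>S. (1 - z) * (\<Prod>i\<in>insert k S-{j}. (1 - z * (a i / a j)) / (1 - a i / a j)) / (1 - w * a j))"
  proof (rule sum.cong[OF refl])
    fix j assume j: "j \<in> S"
    have "insert k S - {j} = insert k (S - {j})" using j insert.hyps by auto
    thus "C j * ((1 - z * (?b / a j)) / (1 - ?b / a j)) / (1 - w * a j) =
       (1 - z) * (\<Prod>i\<in>insert k S-{j}. (1 - z * (a i / a j)) / (1 - a i / a j)) / (1 - w * a j)"
      using insert.hyps by (simp add: C_def)
  qed
  finally show ?case
    unfolding residue[symmetric] using insert.hyps by simp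
qed

lemma prod_int_interval:
  "(\<Prod>i\<in>{-int M..<int N}. g i) = (\<Prod>i<N. g (int i)) * (\<Prod>i<M. g (- int (Suc i)))"
proof -
  have "{-int M..<int N} = {0..<int N} \<union> {-int M..<0}" by auto
  hence "(\<Prod>i\<in>{-int M..<int N}. g i) = (\<Prod>i\<in>{0..<int N}. g i) * (\<Prod>i\<in>{-int M..<0}. g i)"
    by (subst prod.union_disjoint[symmetric]) auto
  also have "(\<Prod>i\<in>{0..<int N}. g i) = (\<Prod>i<N. g (int i))"
    by (rule prod.reindex_bij_witness[of _ int nat]) auto
  also have "(\<Prod>i\<in>{-int M..<0}. g i) = (\<Prod>i<M. g (- int (Suc i)))"
    by (rule prod.reindex_bij_witness[of _ "\<lambda>i. - int (Suc i)" "\<lambda>i. nat (-i) - 1"]) auto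
  finally show ?thesis .
qed

text \<open>
  A factor with negative index turns into a factor of the second half of a theta product, at the
  expense of a factor \<open>z\<close>.
\<close>
lemma theta_ratio_negative:
  fixes q z w :: complex
  assumes "q \<noteq> 0" "z \<noteq> 0" "w \<noteq> 0"
  shows "(1 - z * w * q powi (- int (Suc i))) / (1 - w * q powi (- int (Suc i))) =
           z * ((1 - q / (z * w) * q ^ i) / (1 - q / w * q ^ i))"
proof -
  define x where "x = q ^ Suc i"
  have x: "x \<noteq> 0" using assms by (simp add: x_def)
  have "q powi (- int (Suc i)) = 1 / x"
    by (simp add: x_def power_int_minus divide_inverse del: of_nat_Suc power_Suc)
  moreover have "q / y * q ^ i = x / y" for y by (simp add: x_def)
  moreover have "(1 - z * w * (1 / x)) / (1 - w * (1 / x)) = z * ((1 - x / (z * w)) / (1 - x / w))"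
  proof (cases "w = x")
    case True
    thus ?thesis using x by simp
  next
    case False
    thus ?thesis using assms x by (simp add: divide_simps) (simp add: algebra_simps)
  qed
  ultimately show ?thesis by metis
qed

text \<open>
  For \<open>j \<rightarrow> \<infinity>\<close> the terms decay like \<open>z\<^sup>j\<close>, and for \<open>j \<rightarrow> -\<infinity>\<close> like \<open>(q/z)^(-j)\<close>: the annulus
  \<open>\<bar>q\<bar> < \<bar>z\<bar> < 1\<close> is where both tails converge.
\<close>
lemma kronecker_summable:
  fixes q z w :: complex
  assumes q: "q \<noteq> 0" "norm q < norm z" and z: "norm z < 1"
    and w: "w \<noteq> 0"
  shows "(\<lambda>j::int. z powi j / (1 - w * q powi j)) summable_on UNIV"
proof (rule summable_on_int)
  have z0: "z \<noteq> 0" and q1: "norm q < 1" using q z by auto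
  have q_lim: "(\<lambda>n. q ^ n) \<longlonglongrightarrow> 0" using q1 by (rule LIMSEQ_power_zero)
  have geo: "summable (\<lambda>n. norm (x ^ n * f n))"
    if "f \<longlonglongrightarrow> L" "norm x < 1" for x L :: complex and f
  proof -
    from convergent_imp_Bseq[OF convergentI[OF that(1)]]
    obtain K where K: "\<And>n. norm (f n) \<le> K" unfolding Bseq_def by blast
    have "summable (\<lambda>n. norm x ^ n * K)"
      using that by (intro summable_mult2 summable_geometric) auto
    thus ?thesis
      by (rule summable_comparison_test[rotated])
         (auto simp: norm_mult norm_power intro!: exI[of _ 0] mult_left_mono K)
  qed
  have "(\<lambda>n. inverse (1 - w * q ^ n)) \<longlonglongrightarrow> inverse (1 - w * 0)"
    by (intro tendsto_intros q_lim) auto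
  from geo[OF this z] show "summable (\<lambda>n. norm (z powi int n / (1 - w * q powi int n)))"
    by (simp add: divide_inverse)
  have "(\<lambda>n. inverse (q ^ n - w)) \<longlonglongrightarrow> inverse (0 - w)"
    using w by (intro tendsto_intros q_lim) auto
  moreover have "norm (q / z) < 1" using q z0 by (simp add: norm_divide divide_simps)
  ultimately have "summable (\<lambda>n. norm ((q / z) ^ n * inverse (q ^ n - w)))" by (rule geo)
  moreover have "(q / z) ^ n * inverse (q ^ n - w) = z powi (- int n) / (1 - w * q powi (- int n))" for n
    using q z0 by (simp add: power_int_minus field_simps power_divide)
  ultimately show "summable (\<lambda>n. norm (z powi (- int n) / (1 - w * q powi (- int n))))"
    by simp
qed

text \<open>
  The partial fraction expansion for the nodes \<open>q\<^sup>i\<close>, \<open>-N \<le> i < N\<close>, divided by \<open>z\<^sup>N\<close>. Because the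
  nodes are in geometric progression, every coefficient is, up to a power of \<open>z\<close>, a product of four finite
  q-Pochhammer symbols, and so has a limit that does not depend on \<open>j\<close>.
\<close>
lemma kronecker_finite:
  fixes q z w :: complex
  assumes q: "q \<noteq> 0" "norm q < 1" and z: "z \<noteq> 0" and w: "w \<noteq> 0" "\<And>j. w * q powi j \<noteq> 1"
  shows "qpoch_fin (z * w) q N * qpoch_fin (q / (z * w)) q N / (qpoch_fin w q N * qpoch_fin (q / w) q N) =
    z ^ N + (\<Sum>j\<in>{-int N..<int N}. 
       qpoch_fin z q (nat (int N - j)) * qpoch_fin (q / z) q (nat (int N + j)) /
         (qpoch_fin q q (nat (int N - j) - 1) * qpoch_fin q q (nat (int N + j))) *
       (z powi j / (1 - w * q powi j)))"
proof -
  let ?S = "{-int N..<int N}"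
  have inj: "inj_on ((powi) q) ?S"
  proof (rule inj_onI)
    fix i j assume "q powi i = q powi j"
    hence "q powi (i - j) = 1" using q by (simp add: power_int_diff)
    thus "i = j" using power_int_neq_1[OF q(2), of "i - j"] by auto
  qed
  have coeff: "(1 - z) * (\<Prod>i\<in>?S-{j}. (1 - z * (q powi i / q powi j)) / (1 - q powi i / q powi j)) =
     z powi (int N + j) * (qpoch_fin z q (nat (int N - j)) * qpoch_fin (q / z) q (nat (int N + j)) /
         (qpoch_fin q q (nat (int N - j) - 1) * qpoch_fin q q (nat (int N + j))))" (is "_ = ?rhs")
    if j: "j \<in> ?S" for j
  proof -
    define M where "M = nat (int N + j)"
    obtain K where K: "nat (int N - j) = Suc K" using j by (cases "nat (int N - j)") auto
    have MK: "int M = int N + j" "int (Suc K) = int N - j" using j K by (auto simp: M_def)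
    \<comment> \<open>the excluded factor \<open>i = j\<close> is replaced by 1, so that the product runs over a full interval\<close>
    define G where "G k = (if k = 0 then 1 else (1 - z * q powi k) / (1 - q powi k))" for k :: int
    have "(\<Prod>i\<in>?S-{j}. (1 - z * (q powi i / q powi j)) / (1 - q powi i / q powi j)) = (\<Prod>i\<in>?S-{j}. G (i - j))"
      using q by (intro prod.cong refl) (auto simp: G_def power_int_diff)
    also have "\<dots> = (\<Prod>i\<in>?S. G (i - j))"
      using j by (intro prod.mono_neutral_left) (auto simp: G_def)
    also have "\<dots> = (\<Prod>k\<in>{-int M..<int (Suc K)}. G k)"
      by (rule prod.reindex_bij_witness[of _ "\<lambda>k. k + j" "\<lambda>i. i - j"]) (use MK in auto)
    also have "\<dots> = (\<Prod>i<Suc K. G (int i)) * (\<Prod>i<M. G (- int (Suc i)))"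
      by (rule prod_int_interval)
    also have "(\<Prod>i<M. G (- int (Suc i))) = (\<Prod>i<M. z * ((1 - q / z * q ^ i) / (1 - q * q ^ i)))"
      using theta_ratio_negative[of q z 1] q z
      by (intro prod.cong refl) (simp add: G_def del: of_nat_Suc)
    also have "\<dots> = z ^ M * (qpoch_fin (q / z) q M / qpoch_fin q q M)"
      by (simp add: qpoch_fin_def prod.distrib prod_dividef)
    also have "(\<Prod>i<Suc K. G (int i)) = (\<Prod>i<K. (1 - z * q ^ Suc i) / (1 - q * q ^ i))"
      by (subst prod.lessThan_Suc_shift)
         (simp add: G_def power_int_def nat_add_distrib)
    also have "\<dots> = (\<Prod>i<K. (1 - z * q ^ Suc i)) / qpoch_fin q q K"
      by (simp add: qpoch_fin_def prod_dividef)
    finally have "(1 - z) * (\<Prod>i\<in>?S-{j}. (1 - z * (q powi i / q powi j)) / (1 - q powi i / q powi j))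
       = z ^ M * (((1 - z) * (\<Prod>i<K. (1 - z * q ^ Suc i))) * qpoch_fin (q / z) q M / (qpoch_fin q q K * qpoch_fin q q M))"
      by simp
    also have "(1 - z) * (\<Prod>i<K. (1 - z * q ^ Suc i)) = qpoch_fin z q (Suc K)"
      unfolding qpoch_fin_def by (subst prod.lessThan_Suc_shift) simp
    finally show ?thesis
      unfolding K M_def[symmetric] MK(1)[symmetric] by (simp add: power_int_of_nat)
  qed
  have "(\<Prod>i\<in>?S. (1 - z * w * q powi i) / (1 - w * q powi i)) =
     z ^ N * (qpoch_fin (z * w) q N * qpoch_fin (q / (z * w)) q N / (qpoch_fin w q N * qpoch_fin (q / w) q N))"
    unfolding prod_int_interval using theta_ratio_negative[OF q(1) z w(1)]
    by (simp add: qpoch_fin_def prod.distrib prod_dividef del: of_nat_Suc)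
  also have "(\<Prod>i\<in>?S. (1 - z * w * q powi i) / (1 - w * q powi i)) =
     z ^ card ?S + (\<Sum>j\<in>?S. (1 - z) * (\<Prod>i\<in>?S-{j}. (1 - z * (q powi i / q powi j)) / (1 - q powi i / q powi j)) / (1 - w * q powi j))"
    by (rule partial_fractions_prod) (use inj q w in auto)
  also have "card ?S = N + N" by simp
  also have "(\<Sum>j\<in>?S. (1 - z) * (\<Prod>i\<in>?S-{j}. (1 - z * (q powi i / q powi j)) / (1 - q powi i / q powi j)) / (1 - w * q powi j))
   = z ^ N * (\<Sum>j\<in>?S. 
       qpoch_fin z q (nat (int N - j)) * qpoch_fin (q / z) q (nat (int N + j)) /
         (qpoch_fin q q (nat (int N - j) - 1) * qpoch_fin q q (nat (int N + j))) *
       (z powi j / (1 - w * q powi j)))"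
    unfolding sum_distrib_left
    by (intro sum.cong refl, subst coeff) (use z in \<open>simp_all add: power_int_add\<close>)
  finally have "z ^ N * (qpoch_fin (z * w) q N * qpoch_fin (q / (z * w)) q N / (qpoch_fin w q N * qpoch_fin (q / w) q N)) =
    z ^ N * (z ^ N + (\<Sum>j\<in>?S.
       qpoch_fin z q (nat (int N - j)) * qpoch_fin (q / z) q (nat (int N + j)) /
         (qpoch_fin q q (nat (int N - j) - 1) * qpoch_fin q q (nat (int N + j))) *
       (z powi j / (1 - w * q powi j))))"
    by (simp only: power_add distrib_left)
  thus ?thesis using z by (simp only: mult_left_cancel power_not_zero not_False_eq_True)
qed

text \<open>
  Kronecker's formula, the special case \<open>b = a q\<close> of Ramanujan's \<open>\<^sub>1\<psi>\<^sub>1\<close> summation. In the limit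
  \<open>N \<rightarrow> \<infinity>\<close> of the finite expansion the constant term \<open>z\<^sup>N\<close> disappears, and all coefficients tend to the
  same number \<open>\<rho>\<close>.
\<close>
theorem kronecker_lambert_series:
  fixes q z w :: complex
  assumes q: "q \<noteq> 0" "norm q < norm z" and z: "norm z < 1"
    and w: "w \<noteq> 0" "\<And>j. w * q powi j \<noteq> 1"
  shows "((\<lambda>j::int. z powi j / (1 - w * q powi j)) has_sum
           (qpoch q q)\<^sup>2 * (qpoch (z * w) q * qpoch (q / (z * w)) q) /
           (qpoch z q * qpoch (q / z) q * (qpoch w q * qpoch (q / w) q))) UNIV"
proof -
  have z0: "z \<noteq> 0" and q1: "norm q < 1" using q z by auto
  have qz: "norm (q / z) < 1" using q z0 by (simp add: norm_divide divide_simps)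
  define u where "u j = z powi j / (1 - w * q powi j)" for j :: int
  define R where "R N j = qpoch_fin z q (nat (int N - j)) * qpoch_fin (q / z) q (nat (int N + j)) /
         (qpoch_fin q q (nat (int N - j) - 1) * qpoch_fin q q (nat (int N + j)))" for N j
  define \<rho> where "\<rho> = qpoch z q * qpoch (q / z) q / (qpoch q q * qpoch q q)"
  note lim = qpoch_fin_LIMSEQ[OF q1]
  have qq: "qpoch q q \<noteq> 0" using q1 by (intro qpoch_nonzero') auto
  have \<rho>: "\<rho> \<noteq> 0"
    using qpoch_nonzero'[OF q1 z] qpoch_nonzero'[OF q1 qz] qq by (simp add: \<rho>_def)
  have "qpoch w q \<noteq> 0"
    using w(2)[of "int i" for i] q1 by (intro qpoch_nonzero) auto
  moreover have "qpoch (q / w) q \<noteq> 0"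
  proof (rule qpoch_nonzero[OF q1])
    fix i
    have "w * q powi (- int (Suc i)) \<noteq> 1" by (rule w)
    thus "q / w * q ^ i \<noteq> 1"
      using w(1) q(1) by (auto simp: power_int_minus field_simps simp del: of_nat_Suc)
  qed
  ultimately have ww: "qpoch w q * qpoch (q / w) q \<noteq> 0" by simp
  obtain C1 where C1: "C1 > 0" "\<And>n. norm (qpoch_fin z q n) \<le> C1" using qpoch_fin_bounded[OF q1] by blast
  obtain C2 where C2: "C2 > 0" "\<And>n. norm (qpoch_fin (q / z) q n) \<le> C2" using qpoch_fin_bounded[OF q1] by blast
  obtain C3 where C3: "C3 > 0" "\<And>n. norm (inverse (qpoch_fin q q n)) \<le> C3"
    using inverse_qpoch_fin_bounded[OF q1 q1] by blast
  have R_bound: "norm (R N j) \<le> C1 * C2 * (C3 * C3)" for N j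
  proof -
    have "R N j = qpoch_fin z q (nat (int N - j)) * qpoch_fin (q / z) q (nat (int N + j)) *
        (inverse (qpoch_fin q q (nat (int N - j) - 1)) * inverse (qpoch_fin q q (nat (int N + j))))"
      by (simp add: R_def field_simps)
    also have "norm \<dots> \<le> C1 * C2 * (C3 * C3)"
      unfolding norm_mult
      by (intro mult_mono C1(2) C2(2) C3(2)) (use C1(1) C2(1) C3(1) in auto)
    finally show ?thesis .
  qed
  have R_lim: "(\<lambda>N. R N j) \<longlonglongrightarrow> \<rho>" for j
  proof -
    have eq: "nat (int N - j) - 1 = nat (int N + (- j - 1))" for N by auto
    show ?thesis
      unfolding R_def \<rho>_def eq unfolding diff_conv_add_uminus
      by (intro tendsto_intros tendsto_comp_nat_offset lim) (use qq in auto)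
  qed
  have u: "u summable_on UNIV"
    unfolding u_def using kronecker_summable q z w by blast
  hence u': "(\<lambda>j. norm (u j)) summable_on UNIV"
    by (simp add: summable_on_iff_abs_summable_on_complex)
  have "(\<lambda>N. \<Sum>j\<in>{-int N..<int N}. R N j * u j) \<longlonglongrightarrow> infsum (\<lambda>j. \<rho> * u j) UNIV"
  proof (rule sum_tendsto_dominated)
    show "(\<lambda>j. C1 * C2 * (C3 * C3) * norm (u j)) summable_on UNIV"
      using u' by (rule summable_on_cmult_right)
    show "(\<lambda>N. if j \<in> {-int N..<int N} then R N j * u j else 0) \<longlonglongrightarrow> \<rho> * u j" for j
    proof (rule Lim_transform_eventually)
      show "(\<lambda>N. R N j * u j) \<longlonglongrightarrow> \<rho> * u j" by (intro tendsto_intros R_lim)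
      show "eventually (\<lambda>N. R N j * u j = (if j \<in> {-int N..<int N} then R N j * u j else 0)) sequentially"
        using eventually_gt_at_top[of "nat \<bar>j\<bar>"] by eventually_elim auto
    qed
    show "norm (R N j * u j) \<le> C1 * C2 * (C3 * C3) * norm (u j)" for N j
      unfolding norm_mult using R_bound by (intro mult_right_mono) (auto simp: norm_mult)
    show "C1 * C2 * (C3 * C3) * norm (u j) \<ge> 0" for j
      using C1 C2 C3 by simp
  qed auto
  moreover have "(\<lambda>N. z ^ N) \<longlonglongrightarrow> 0" using z by (rule LIMSEQ_power_zero)
  ultimately have "(\<lambda>N. z ^ N + (\<Sum>j\<in>{-int N..<int N}. R N j * u j)) \<longlonglongrightarrow> 0 + infsum (\<lambda>j. \<rho> * u j) UNIV"
    by (intro tendsto_add)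
  moreover have "(\<lambda>N. qpoch_fin (z * w) q N * qpoch_fin (q / (z * w)) q N / (qpoch_fin w q N * qpoch_fin (q / w) q N))
     \<longlonglongrightarrow> qpoch (z * w) q * qpoch (q / (z * w)) q / (qpoch w q * qpoch (q / w) q)"
    by (intro tendsto_intros lim ww)
  hence "(\<lambda>N. z ^ N + (\<Sum>j\<in>{-int N..<int N}. R N j * u j))
     \<longlonglongrightarrow> qpoch (z * w) q * qpoch (q / (z * w)) q / (qpoch w q * qpoch (q / w) q)"
    unfolding kronecker_finite[OF q(1) q1 z0 w] R_def u_def .
  ultimately have "\<rho> * infsum u UNIV = qpoch (z * w) q * qpoch (q / (z * w)) q / (qpoch w q * qpoch (q / w) q)"
    by (simp add: LIMSEQ_unique infsum_cmult_right')
  hence "infsum u UNIV = qpoch (z * w) q * qpoch (q / (z * w)) q / (qpoch w q * qpoch (q / w) q) / \<rho>"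
    using \<rho> by (metis nonzero_mult_div_cancel_left)
  also have "\<dots> = (qpoch q q)\<^sup>2 * (qpoch (z * w) q * qpoch (q / (z * w)) q) /
           (qpoch z q * qpoch (q / z) q * (qpoch w q * qpoch (q / w) q))"
    by (simp add: \<rho>_def power2_eq_square mult_ac)
  finally show ?thesis
    using has_sum_infsum[OF u] by (simp only: u_def[abs_def])
qed

section \<open>The Jacobi triple product\<close>

text \<open>
  The Gaussian binomial coefficient. The quotient makes its limit for large arguments visible; its
  denominator does not vanish if \<open>\<bar>p\<bar> < 1\<close>.
\<close>
definition qbinom :: "complex \<Rightarrow> nat \<Rightarrow> nat \<Rightarrow> complex" where
  "qbinom p n k = qpoch_fin p p n / (qpoch_fin p p k * qpoch_fin p p (n - k))"

lemma qpoch_fin_self_nonzero: "norm p < 1 \<Longrightarrow> qpoch_fin p p n \<noteq> 0"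
proof (rule qpoch_fin_nonzero)
  fix i assume "norm p < 1"
  hence "norm (p * p ^ i) < 1"
    using power_less_one_iff[of "norm p" "Suc i"] by (simp add: norm_mult norm_power)
  thus "p * p ^ i \<noteq> 1" by auto
qed

lemma qpoch_fin_Suc: "qpoch_fin a q (Suc n) = qpoch_fin a q n * (1 - a * q ^ n)"
  by (simp add: qpoch_fin_def)

lemma qbinom_pascal:
  assumes "norm p < 1" and "k < n"
  shows "qbinom p (Suc n) (Suc k) = qbinom p n (Suc k) + p ^ (n - k) * qbinom p n k"
proof -
  obtain m where m: "n = k + Suc m" using assms(2) by (auto simp: less_iff_Suc_add)
  note nz = qpoch_fin_self_nonzero[OF assms(1)]
  have nz': "1 - p * p ^ i \<noteq> 0" for i
    using nz[of "Suc i"] by (simp add: qpoch_fin_Suc)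
  show ?thesis
    using nz nz'
    by (simp add: qbinom_def m qpoch_fin_Suc divide_simps power_add) (simp add: algebra_simps)
qed

lemma qbinom_self: "norm p < 1 \<Longrightarrow> qbinom p n n = 1" "norm p < 1 \<Longrightarrow> qbinom p n 0 = 1"
  using qpoch_fin_self_nonzero[of p n] by (auto simp: qbinom_def qpoch_fin_def)

lemma square_Suc: "(Suc n)\<^sup>2 = n\<^sup>2 + (2 * n + 1)"
  by (simp add: power2_eq_square)

text \<open>
  The base is \<open>q\<^sup>2\<close> and the exponents are odd, because then the powers of \<open>q\<close> in the expansion are
  exactly the squares.
\<close>
lemma q_binomial_theorem:
  fixes q x :: complex
  assumes "norm q < 1"
  shows "(\<Prod>i<n. 1 + x * q ^ (2 * i + 1)) = (\<Sum>k\<le>n. qbinom (q\<^sup>2) n k * (q ^ k\<^sup>2 * x ^ k))"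
proof (induction n)
  case 0
  show ?case by (simp add: qbinom_def qpoch_fin_def)
next
  case (Suc n)
  have p: "norm (q\<^sup>2) < 1" using assms by (simp add: norm_power power_less_one_iff)
  define f where "f n k = qbinom (q\<^sup>2) n k * (q ^ k\<^sup>2 * x ^ k)" for n k
  have step: "f n (Suc k) + f n k * (x * q ^ (2 * n + 1)) = f (Suc n) (Suc k)" if "k < n" for k
  proof -
    have "2 * n + 1 + k\<^sup>2 = 2 * (n - k) + (Suc k)\<^sup>2"
      using that by (simp add: power2_eq_square algebra_simps)
    hence "q ^ (2 * n + 1) * q ^ k\<^sup>2 = (q\<^sup>2) ^ (n - k) * q ^ (Suc k)\<^sup>2"
      by (simp only: power_add[symmetric] power_mult[symmetric])
    thus ?thesis
      unfolding f_def qbinom_pascal[OF p that] by (simp add: algebra_simps)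
  qed
  have last: "f n n * (x * q ^ (2 * n + 1)) = f (Suc n) (Suc n)"
    unfolding f_def qbinom_self(1)[OF p] square_Suc power_add by simp
  have first: "f n 0 = f (Suc n) 0"
    by (simp add: f_def qbinom_self[OF p])
  have "(\<Prod>i<Suc n. 1 + x * q ^ (2 * i + 1)) = (\<Sum>k\<le>n. f n k) * (1 + x * q ^ (2 * n + 1))"
    using Suc.IH by (simp add: f_def)
  also have "\<dots> = (\<Sum>k\<le>n. f n k) + (\<Sum>k\<le>n. f n k * (x * q ^ (2 * n + 1)))"
    by (simp add: algebra_simps sum_distrib_left sum_distrib_right)
  also have "(\<Sum>k\<le>n. f n k) = f n 0 + (\<Sum>k<n. f n (Suc k))"
    by (rule sum.atMost_shift)
  also have "(\<Sum>k\<le>n. f n k * (x * q ^ (2 * n + 1))) = (\<Sum>k<n. f n k * (x * q ^ (2 * n + 1))) + f (Suc n) (Suc n)"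
    unfolding last[symmetric] by (simp add: lessThan_Suc_atMost[symmetric])
  also have "f n 0 + (\<Sum>k<n. f n (Suc k)) + ((\<Sum>k<n. f n k * (x * q ^ (2 * n + 1))) + f (Suc n) (Suc n))
      = f (Suc n) 0 + ((\<Sum>k<n. f n (Suc k) + f n k * (x * q ^ (2 * n + 1))) + f (Suc n) (Suc n))"
    by (simp only: first sum.distrib add.assoc)
  also have "(\<Sum>k<n. f n (Suc k) + f n k * (x * q ^ (2 * n + 1))) = (\<Sum>k<n. f (Suc n) (Suc k))"
    using step by (intro sum.cong) auto
  also have "f (Suc n) 0 + ((\<Sum>k<n. f (Suc n) (Suc k)) + f (Suc n) (Suc n)) = (\<Sum>k\<le>Suc n. f (Suc n) k)"
    by (subst sum.atMost_shift) simp
  finally show ?case by (simp only: f_def)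
qed

text \<open>The coefficient at distance \<open>n\<close> from the centre of row \<open>2N\<close>, meaningful for \<open>\<bar>n\<bar> \<le> N\<close>.\<close>
definition central_qbinom :: "complex \<Rightarrow> nat \<Rightarrow> int \<Rightarrow> complex" where
  "central_qbinom p N n = qbinom p (2 * N) (nat (int N + n))"

text \<open>
  The q-binomial theorem for \<open>2N\<close> factors, recentred: with \<open>x = z / q\<^sup>2\<^sup>N\<close> the exponents of the factors
  \<open>1 + x q\<^sup>2\<^sup>i\<^sup>+\<^sup>1\<close> run through the odd numbers from \<open>1 - 2N\<close> to \<open>2N - 1\<close>. Extracting \<open>z / q\<^sup>2\<^sup>i\<^sup>+\<^sup>1\<close>
  from each factor with negative exponent yields the common factor \<open>s\<close> of both sides.
\<close>
lemma jacobi_triple_product_finite: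
  fixes q z :: complex
  assumes q: "norm q < 1" "q \<noteq> 0" and z: "z \<noteq> 0"
  shows "qpoch_fin (- z * q) (q\<^sup>2) N * qpoch_fin (- q / z) (q\<^sup>2) N =
           (\<Sum>n\<in>{-int N..int N}. central_qbinom (q\<^sup>2) N n * (q powi n\<^sup>2 * z powi n))"
proof -
  define x where "x = z / q ^ (2 * N)"
  define s where "s = z ^ N / q ^ N\<^sup>2"
  have s: "s \<noteq> 0" using q z by (simp add: s_def)
  have odd_sum: "(\<Prod>i<N. y * q ^ (2 * i + 1)) = y ^ N * q ^ N\<^sup>2" for y
  proof (induction N)
    case (Suc N)
    thus ?case unfolding square_Suc power_add by simp
  qed auto
  have "(\<Prod>i<2*N. 1 + x * q ^ (2 * i + 1)) = (\<Prod>i<N. 1 + x * q ^ (2 * i + 1)) * (\<Prod>i=N..<2*N. 1 + x * q ^ (2 * i + 1))"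
  proof -
    have "{..<2*N} = {..<N} \<union> {N..<2*N}" by auto
    thus ?thesis by (simp add: prod.union_disjoint ivl_disj_int del: atLeastLessThan_iff)
  qed
  also have "(\<Prod>i=N..<2*N. 1 + x * q ^ (2 * i + 1)) = (\<Prod>i<N. 1 + z * q * (q\<^sup>2) ^ i)"
  proof (rule prod.reindex_bij_witness[of _ "\<lambda>i. i + N" "\<lambda>i. i - N"])
    fix i assume "i \<in> {N..<2*N}"
    then obtain j where j: "i = N + j" by (auto simp: le_iff_add)
    show "1 + z * q * (q\<^sup>2) ^ (i - N) = 1 + x * q ^ (2 * i + 1)"
      using q by (simp add: x_def j power_add power_mult[symmetric])
  qed auto
  also have "\<dots> = qpoch_fin (- z * q) (q\<^sup>2) N" by (simp add: qpoch_fin_def)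
  also have "(\<Prod>i<N. 1 + x * q ^ (2 * i + 1)) = (\<Prod>i<N. 1 + x * q ^ (2 * (N - Suc i) + 1))"
    by (rule prod.nat_diff_reindex[symmetric])
  also have "\<dots> = (\<Prod>i<N. (1 + q / z * (q\<^sup>2) ^ i) / (inverse z * q ^ (2 * i + 1)))"
  proof (rule prod.cong[OF refl])
    fix i assume "i \<in> {..<N}"
    then obtain j where j: "N = Suc (i + j)" by (auto simp: less_iff_Suc_add)
    show "1 + x * q ^ (2 * (N - Suc i) + 1) = (1 + q / z * (q\<^sup>2) ^ i) / (inverse z * q ^ (2 * i + 1))"
    proof -
      define r where "r = q ^ (2 * i)"
      have r: "r \<noteq> 0" using q by (simp add: r_def)
      have "2 * N = (2 * j + 1) + (2 * i + 1)" by (simp add: j)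
      hence "x = z / (q ^ (2 * j + 1) * q ^ (2 * i + 1))" by (simp only: x_def power_add)
      hence "x * q ^ (2 * j + 1) = z / q ^ (2 * i + 1)" using q by simp
      moreover have "2 * (N - Suc i) + 1 = 2 * j + 1" by (simp add: j)
      moreover have "q ^ (2 * i + 1) = r * q" "(q\<^sup>2) ^ i = r" by (simp_all add: r_def power_mult)
      ultimately have "x * q ^ (2 * (N - Suc i) + 1) = z / (r * q)" by metis
      moreover have "1 + z / (r * q) = (1 + q / z * r) / (inverse z * (r * q))"
        using q z r by (simp add: field_simps)
      ultimately show ?thesis
        using \<open>q ^ (2 * i + 1) = r * q\<close> \<open>(q\<^sup>2) ^ i = r\<close> by metis
    qed
  qed
  also have "\<dots> = qpoch_fin (- q / z) (q\<^sup>2) N * s"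
  proof -
    have "(\<Prod>i<N. 1 + q / z * (q\<^sup>2) ^ i) = qpoch_fin (- q / z) (q\<^sup>2) N"
      by (simp add: qpoch_fin_def)
    moreover have "a / (inverse z ^ N * b) = a * (z ^ N / b)" for a b :: complex
      by (simp add: power_inverse divide_inverse)
    ultimately show ?thesis unfolding prod_dividef odd_sum s_def by simp
  qed
  finally have L: "(\<Prod>i<2*N. 1 + x * q ^ (2 * i + 1)) = s * (qpoch_fin (- z * q) (q\<^sup>2) N * qpoch_fin (- q / z) (q\<^sup>2) N)"
    by simp
  have "(\<Sum>k\<le>2*N. qbinom (q\<^sup>2) (2*N) k * (q ^ k\<^sup>2 * x ^ k)) =
     (\<Sum>n\<in>{-int N..int N}. s * (central_qbinom (q\<^sup>2) N n * (q powi n\<^sup>2 * z powi n)))"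
  proof (rule sum.reindex_bij_witness[of _ "\<lambda>n. nat (int N + n)" "\<lambda>k. int k - int N"])
    fix k assume k: "k \<in> {..2*N}"
    have "(int k - int N)\<^sup>2 = int (k\<^sup>2) - int (2 * N * k) + int (N\<^sup>2)"
      by (simp add: power2_eq_square algebra_simps)
    hence "q powi (int k - int N)\<^sup>2 = q ^ k\<^sup>2 / q ^ (2 * N * k) * q ^ N\<^sup>2"
      using q by (simp only: power_int_add power_int_diff power_int_of_nat simp_thms)
    moreover have "z powi (int k - int N) = z ^ k / z ^ N"
      using z by (simp only: power_int_diff power_int_of_nat simp_thms)
    moreover have "x ^ k = z ^ k / q ^ (2 * N * k)"
      by (simp only: x_def power_divide power_mult)
    moreover have "(a / b) * (c * (d / e * b * (f / a))) = c * (d * (f / e))"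
      if "a \<noteq> 0" "b \<noteq> 0" for a b c d e f :: complex using that by simp
    moreover have "z ^ N \<noteq> 0" "q ^ N\<^sup>2 \<noteq> 0" using q z by simp_all
    moreover have "central_qbinom (q\<^sup>2) N (int k - int N) = qbinom (q\<^sup>2) (2 * N) k"
      by (simp add: central_qbinom_def)
    ultimately show "s * (central_qbinom (q\<^sup>2) N (int k - int N) * (q powi (int k - int N)\<^sup>2 * z powi (int k - int N))) =
        qbinom (q\<^sup>2) (2 * N) k * (q ^ k\<^sup>2 * x ^ k)"
      by (simp only: s_def)
  qed auto
  hence "s * (qpoch_fin (- z * q) (q\<^sup>2) N * qpoch_fin (- q / z) (q\<^sup>2) N) =
     s * (\<Sum>n\<in>{-int N..int N}. central_qbinom (q\<^sup>2) N n * (q powi n\<^sup>2 * z powi n))"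
    unfolding L[symmetric] q_binomial_theorem[OF q(1)] sum_distrib_left .
  thus ?thesis using s by simp
qed

lemma central_qbinom_eq:
  assumes "\<bar>n\<bar> \<le> int N"
  shows "central_qbinom p N n =
           qpoch_fin p p (2 * N) * (inverse (qpoch_fin p p (nat (int N + n))) * inverse (qpoch_fin p p (nat (int N + (- n)))))"
proof -
  have "2 * N - nat (int N + n) = nat (int N + (- n))" using assms by linarith
  thus ?thesis by (simp add: central_qbinom_def qbinom_def divide_inverse)
qed

text \<open>
  The central Gaussian binomial coefficients are bounded, and each of them tends to \<open>1 / (p; p)\<^sub>\<infinity>\<close>.
\<close>
lemma central_qbinom_sum_tendsto:
  assumes p: "norm p < 1" and g: "g summable_on UNIV"
  shows "(\<lambda>N. \<Sum>n\<in>{-int N..int N}. central_qbinom p N n * g n) \<longlonglongrightarrow> infsum g UNIV / qpoch p p"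
proof -
  note lim = qpoch_fin_LIMSEQ[OF p]
  have pp: "qpoch p p \<noteq> 0" using p by (intro qpoch_nonzero') auto
  obtain C1 where C1: "C1 > 0" "\<And>n. norm (qpoch_fin p p n) \<le> C1" using qpoch_fin_bounded[OF p] by blast
  obtain C2 where C2: "C2 > 0" "\<And>n. norm (inverse (qpoch_fin p p n)) \<le> C2"
    using inverse_qpoch_fin_bounded[OF p p] by blast
  have "strict_mono (\<lambda>N::nat. 2 * N)" by (auto intro: strict_monoI)
  from LIMSEQ_subseq_LIMSEQ[OF lim[of p] this]
  have lim2: "(\<lambda>N. qpoch_fin p p (2 * N)) \<longlonglongrightarrow> qpoch p p" by (simp add: o_def)
  have "(\<lambda>N. \<Sum>n\<in>{-int N..int N}. central_qbinom p N n * g n) \<longlonglongrightarrow> infsum (\<lambda>n. inverse (qpoch p p) * g n) UNIV"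
  proof (rule sum_tendsto_dominated)
    show "(\<lambda>n. C1 * (C2 * C2) * norm (g n)) summable_on UNIV"
      using g by (intro summable_on_cmult_right) (simp add: summable_on_iff_abs_summable_on_complex)
    show "C1 * (C2 * C2) * norm (g n) \<ge> 0" for n using C1 C2 by simp
    show "norm (central_qbinom p N n * g n) \<le> C1 * (C2 * C2) * norm (g n)" if "n \<in> {-int N..int N}" for N n
    proof -
      have "\<bar>n\<bar> \<le> int N" using that by auto
      thus ?thesis
        unfolding central_qbinom_eq[OF \<open>\<bar>n\<bar> \<le> int N\<close>] norm_mult
        using C1(1) C2(1) by (intro mult_right_mono mult_mono C1(2) C2(2)) auto
    qed
    show "(\<lambda>N. if n \<in> {-int N..int N} then central_qbinom p N n * g n else 0)
            \<longlonglongrightarrow> inverse (qpoch p p) * g n" for n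
    proof (rule Lim_transform_eventually)
      have "(\<lambda>N. qpoch_fin p p (2 * N) * (inverse (qpoch_fin p p (nat (int N + n)))
               * inverse (qpoch_fin p p (nat (int N + (- n))))) * g n)
             \<longlonglongrightarrow> qpoch p p * (inverse (qpoch p p) * inverse (qpoch p p)) * g n"
        by (intro tendsto_intros tendsto_comp_nat_offset lim lim2 pp)
      also have "qpoch p p * (inverse (qpoch p p) * inverse (qpoch p p)) = inverse (qpoch p p)"
        using pp by simp
      finally show "(\<lambda>N. qpoch_fin p p (2 * N) * (inverse (qpoch_fin p p (nat (int N + n)))
               * inverse (qpoch_fin p p (nat (int N + (- n))))) * g n) \<longlonglongrightarrow> inverse (qpoch p p) * g n" .
      show "eventually (\<lambda>N. qpoch_fin p p (2 * N) * (inverse (qpoch_fin p p (nat (int N + n)))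
               * inverse (qpoch_fin p p (nat (int N + (- n))))) * g n =
               (if n \<in> {-int N..int N} then central_qbinom p N n * g n else 0)) sequentially"
        using eventually_ge_at_top[of "nat \<bar>n\<bar>"]
      proof eventually_elim
        case (elim N)
        hence n: "\<bar>n\<bar> \<le> int N" by linarith
        hence "n \<in> {-int N..int N}" by auto
        thus ?case unfolding central_qbinom_eq[OF n] by simp
      qed
    qed
  qed auto
  thus ?thesis unfolding infsum_cmult_right' by (simp only: divide_inverse mult.commute)
qed

theorem jacobi_triple_product:
  fixes q z :: complex
  assumes q: "norm q < 1" "q \<noteq> 0" and z: "z \<noteq> 0"
  shows "((\<lambda>n::int. q powi n\<^sup>2 * z powi n) has_sum
           qpoch (q\<^sup>2) (q\<^sup>2) * qpoch (- z * q) (q\<^sup>2) * qpoch (- q / z) (q\<^sup>2)) UNIV"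
proof -
  have p: "norm (q\<^sup>2) < 1" using q by (simp add: norm_power power_less_one_iff)
  have pp: "qpoch (q\<^sup>2) (q\<^sup>2) \<noteq> 0" using p by (intro qpoch_nonzero') auto
  let ?g = "\<lambda>n::int. q powi n\<^sup>2 * z powi n"
  have g: "?g summable_on UNIV" using summable_on_theta[OF q(1) z, of 1 0] by simp
  have "(\<lambda>N. qpoch_fin (- z * q) (q\<^sup>2) N * qpoch_fin (- q / z) (q\<^sup>2) N) \<longlonglongrightarrow>
          infsum ?g UNIV / qpoch (q\<^sup>2) (q\<^sup>2)"
    unfolding jacobi_triple_product_finite[OF q z] by (rule central_qbinom_sum_tendsto[OF p g])
  moreover have "(\<lambda>N. qpoch_fin (- z * q) (q\<^sup>2) N * qpoch_fin (- q / z) (q\<^sup>2) N) \<longlonglongrightarrow>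
          qpoch (- z * q) (q\<^sup>2) * qpoch (- q / z) (q\<^sup>2)"
    by (intro tendsto_mult qpoch_fin_LIMSEQ p)
  ultimately have "infsum ?g UNIV / qpoch (q\<^sup>2) (q\<^sup>2) = qpoch (- z * q) (q\<^sup>2) * qpoch (- q / z) (q\<^sup>2)"
    by (rule LIMSEQ_unique)
  hence "infsum ?g UNIV = qpoch (q\<^sup>2) (q\<^sup>2) * qpoch (- z * q) (q\<^sup>2) * qpoch (- q / z) (q\<^sup>2)"
    using pp by (simp add: field_simps)
  thus ?thesis using has_sum_infsum[OF g] by simp
qed

section \<open>The cube of the Euler product\<close>

text \<open>
  The finite triple product vanishes at \<open>z = -q\<close>, to first order, because of the factor \<open>1 + q/z\<close>. Its
  derivative there is computed from the product, as the value of the remaining factors, and from the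
  sum, term by term.
\<close>
lemma jacobi_cube_finite:
  fixes q :: complex
  assumes q: "norm q < 1" "q \<noteq> 0"
  shows "(\<Sum>n\<in>{-int (Suc N)..int (Suc N)}. central_qbinom (q\<^sup>2) (Suc N) n * (of_int n * (q powi n\<^sup>2 * (- q) powi n)))
          = qpoch_fin (q\<^sup>2) (q\<^sup>2) (Suc N) * qpoch_fin (q\<^sup>2) (q\<^sup>2) N" (is "?S = _")
proof -
  define F where "F z = (\<Sum>n\<in>{-int (Suc N)..int (Suc N)}. central_qbinom (q\<^sup>2) (Suc N) n * (q powi n\<^sup>2 * z powi n))" for z
  define G where "G z = qpoch_fin (- z * q) (q\<^sup>2) (Suc N) * (\<Prod>i<N. 1 + q / z * (q\<^sup>2) ^ Suc i) / z" for z
  have FG: "F z = G z * (z - (- q))" if "z \<noteq> 0" for z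
  proof -
    have "qpoch_fin (- q / z) (q\<^sup>2) (Suc N) = (1 + q / z) * (\<Prod>i<N. 1 + q / z * (q\<^sup>2) ^ Suc i)"
      unfolding qpoch_fin_def by (subst prod.lessThan_Suc_shift) simp
    hence "F z = qpoch_fin (- z * q) (q\<^sup>2) (Suc N) * ((1 + q / z) * (\<Prod>i<N. 1 + q / z * (q\<^sup>2) ^ Suc i))"
      unfolding F_def jacobi_triple_product_finite[OF q that, symmetric] by simp
    moreover have "1 + q / z = (z - (- q)) / z" using that by (simp add: field_simps)
    ultimately show ?thesis by (simp add: G_def)
  qed
  have "isCont G (- q)"
    unfolding G_def qpoch_fin_def using q by (intro continuous_intros) auto
  hence "G \<midarrow>-q\<rightarrow> G (- q)" by (rule isContD)
  moreover have "eventually (\<lambda>z. G z = (F z - F (- q)) / (z - (- q))) (at (- q))"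
    using eventually_neq_at_within[of "-q" "-q" UNIV] eventually_neq_at_within[of 0 "-q" UNIV]
    by eventually_elim (use FG q in \<open>auto simp: eq_neg_iff_add_eq_0\<close>)
  ultimately have "(\<lambda>z. (F z - F (- q)) / (z - (- q))) \<midarrow>-q\<rightarrow> G (- q)"
    by (rule Lim_transform_eventually)
  hence 1: "(F has_field_derivative G (- q)) (at (- q))"
    by (simp add: has_field_derivative_iff)
  have "(F has_field_derivative (\<Sum>n\<in>{-int (Suc N)..int (Suc N)}. 
          central_qbinom (q\<^sup>2) (Suc N) n * (q powi n\<^sup>2 * (of_int n * (- q) powi (n - 1) * 1)))) (at (- q))"
    unfolding F_def
    by (intro DERIV_sum DERIV_cmult DERIV_power_int DERIV_ident) (use q in auto)
  with 1 have "G (- q) = (\<Sum>n\<in>{-int (Suc N)..int (Suc N)}. 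
          central_qbinom (q\<^sup>2) (Suc N) n * (q powi n\<^sup>2 * (of_int n * (- q) powi (n - 1) * 1)))"
    by (rule DERIV_unique)
  also have "(- q) * \<dots> = ?S"
    unfolding sum_distrib_left using q
    by (intro sum.cong refl) (simp add: power_int_diff)
  finally have "?S = (- q) * G (- q)" by simp
  also have "\<dots> = qpoch_fin (q\<^sup>2) (q\<^sup>2) (Suc N) * qpoch_fin (q\<^sup>2) (q\<^sup>2) N"
    using q by (simp add: G_def) (simp add: qpoch_fin_def power2_eq_square)
  finally show ?thesis .
qed

text \<open>
  Jacobi's formula \<open>(p; p)\<^sub>\<infinity>\<^sup>3 = 1 - 3p + 5p\<^sup>3 - \<dots>\<close> with \<open>p = q\<^sup>2\<close>, written as a sum over all integers with weight
  \<open>n\<close>; the terms \<open>n\<close> and \<open>-1 - n\<close> have the same power of \<open>q\<close> and combine to the weight \<open>2n + 1\<close>.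
\<close>
theorem jacobi_cube:
  fixes q :: complex
  assumes q: "norm q < 1" "q \<noteq> 0"
  shows "((\<lambda>n::int. of_int n * (q powi n\<^sup>2 * (- q) powi n)) has_sum qpoch (q\<^sup>2) (q\<^sup>2) ^ 3) UNIV"
proof -
  have p: "norm (q\<^sup>2) < 1" using q by (simp add: norm_power power_less_one_iff)
  have pp: "qpoch (q\<^sup>2) (q\<^sup>2) \<noteq> 0" using p by (intro qpoch_nonzero') auto
  let ?g = "\<lambda>n::int. of_int n * (q powi n\<^sup>2 * (- q) powi n)"
  have g: "?g summable_on UNIV" using summable_on_theta[OF q(1), of "-q" 0 1] q by simp
  have "(\<lambda>N. qpoch_fin (q\<^sup>2) (q\<^sup>2) (Suc N) * qpoch_fin (q\<^sup>2) (q\<^sup>2) N) \<longlonglongrightarrow>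
          infsum ?g UNIV / qpoch (q\<^sup>2) (q\<^sup>2)"
    unfolding jacobi_cube_finite[OF q, symmetric]
    by (rule LIMSEQ_Suc[OF central_qbinom_sum_tendsto[OF p g]])
  moreover have "(\<lambda>N. qpoch_fin (q\<^sup>2) (q\<^sup>2) (Suc N) * qpoch_fin (q\<^sup>2) (q\<^sup>2) N) \<longlonglongrightarrow>
          qpoch (q\<^sup>2) (q\<^sup>2) * qpoch (q\<^sup>2) (q\<^sup>2)"
    by (intro tendsto_mult LIMSEQ_Suc qpoch_fin_LIMSEQ p)
  ultimately have "infsum ?g UNIV / qpoch (q\<^sup>2) (q\<^sup>2) = qpoch (q\<^sup>2) (q\<^sup>2) * qpoch (q\<^sup>2) (q\<^sup>2)"
    by (rule LIMSEQ_unique)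
  hence "infsum ?g UNIV = qpoch (q\<^sup>2) (q\<^sup>2) ^ 3"
    using pp by (simp add: field_simps power3_eq_cube)
  thus ?thesis using has_sum_infsum[OF g] by simp
qed

section \<open>Special theta series\<close>

lemma theta_squares:
  fixes q :: complex
  assumes q: "norm q < 1" "q \<noteq> 0"
  shows "((\<lambda>n::int. q powi n\<^sup>2) has_sum
           qpoch (q\<^sup>2) (q\<^sup>2) ^ 5 / (qpoch q q ^ 2 * qpoch (q ^ 4) (q ^ 4) ^ 2)) UNIV"
proof -
  have p: "norm (q\<^sup>2) < 1" using norm_power_less_1[OF q(1), of 2] by simp
  note nz = qpoch_self_nonzero[OF q(1), of 1] qpoch_self_nonzero[OF q(1), of 2] qpoch_self_nonzero[OF q(1), of 4]
  have "qpoch q (q\<^sup>2) * qpoch (- q) (q\<^sup>2) = qpoch (q\<^sup>2) ((q\<^sup>2)\<^sup>2)"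
    by (rule qpoch_mult_minus[OF p])
  also have "\<dots> = qpoch (q\<^sup>2) (q\<^sup>2) / qpoch (q ^ 4) (q ^ 4)"
    using qpoch_odd[OF p] by simp
  finally have "qpoch (- q) (q\<^sup>2) = qpoch (q\<^sup>2) (q\<^sup>2) ^ 2 / (qpoch q q * qpoch (q ^ 4) (q ^ 4))"
    using nz unfolding qpoch_odd[OF q(1)] by (simp add: field_simps power2_eq_square)
  moreover have "a * (a ^ 2 / (b * c)) * (a ^ 2 / (b * c)) = a ^ 5 / (b ^ 2 * c ^ 2)" for a b c :: complex
    by (simp add: eval_nat_numeral mult_ac)
  ultimately have "qpoch (q\<^sup>2) (q\<^sup>2) * qpoch (- q) (q\<^sup>2) * qpoch (- q) (q\<^sup>2) =
           qpoch (q\<^sup>2) (q\<^sup>2) ^ 5 / (qpoch q q ^ 2 * qpoch (q ^ 4) (q ^ 4) ^ 2)"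
    by metis
  thus ?thesis
    using jacobi_triple_product[OF q, of 1] by simp
qed

text \<open>
  The pentagonal number theorem in the variable \<open>q\<^sup>4\<close>: the triple product with base \<open>q\<^sup>1\<^sup>2\<close> consists of
  the three residue classes of exponents modulo 3.
\<close>
lemma theta_pentagonal:
  fixes q :: complex
  assumes q: "norm q < 1" "q \<noteq> 0"
  shows "((\<lambda>n::int. (q ^ 6) powi n\<^sup>2 * (- (q\<^sup>2)) powi n) has_sum qpoch (q ^ 4) (q ^ 4)) UNIV"
proof -
  have "qpoch (q ^ 4) (q ^ 4) = qpoch (q ^ 12) (q ^ 12) * qpoch (q ^ 8) (q ^ 12) * qpoch (q ^ 4) (q ^ 12)"
    using qpoch_mod3[OF norm_power_less_1[OF q(1), of 4], of "q ^ 4"]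
    by (simp add: power_add[symmetric] power_mult[symmetric])
  moreover have "- (q ^ 6) / - (q\<^sup>2) = q ^ 4"
    using q by (simp add: field_simps power_add[symmetric])
  ultimately show ?thesis
    using jacobi_triple_product[OF norm_power_less_1[OF q(1), of 6], of "- (q\<^sup>2)"] q
    by (simp add: power_add[symmetric] power_mult[symmetric])
qed

text \<open>The product side contains the factor \<open>1 + q/z\<close>, which is zero for \<open>z = -q\<close>.\<close>
lemma theta_vanishing:
  fixes q :: complex
  assumes q: "norm q < 1" "q \<noteq> 0"
  shows "((\<lambda>n::int. q powi n\<^sup>2 * (- q) powi n) has_sum 0) UNIV"
  using jacobi_triple_product[OF q, of "-q"] q qpoch_1_eq_0[OF norm_power_less_1[OF q(1), of 2]]
  by simp

text \<open>The common normal form in which exponents from different bases are compared.\<close>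
lemma theta_term:
  fixes q :: complex
  assumes "q \<noteq> 0"
  shows "(q ^ a) powi n\<^sup>2 * (- (q ^ b)) powi n = (-1) powi n * q powi (int a * n\<^sup>2 + int b * n)"
proof -
  have "(- (q ^ b)) powi n = (-1) powi n * (q ^ b) powi n"
    by (metis mult_minus1 power_int_mult_distrib)
  moreover have "(q ^ c) powi m = q powi (int c * m)" for c m
    by (simp add: power_int_mult)
  ultimately show ?thesis using assms by (simp add: power_int_add)
qed

section \<open>The theta series of weight 3/2\<close>

text \<open>
  The double series \<open>T\<close> is evaluated in two ways. As the sum of \<open>g\<close> is 0, any constant may be added
  to the weight \<open>m + 2n\<close>, which is \<open>3k + r\<close> in the grouping by residues modulo 3. With the constant 1 the
  classes \<open>r = 0\<close> and \<open>r = 1\<close> carry the weights \<open>3k + 1\<close> and \<open>3k + 2\<close>, which are exchanged up to sign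
  by \<open>k \<mapsto> -k - 1\<close>; this is why the two classes have the same sum.
\<close>
theorem weight_three_halves_theta:
  fixes q :: complex
  assumes q: "norm q < 1" "q \<noteq> 0"
  shows "((\<lambda>k::int. of_int (3 * k + 1) * ((q ^ 3) powi k\<^sup>2 * (- (q\<^sup>2)) powi k)) has_sum
           qpoch (q\<^sup>2) (q\<^sup>2) ^ 5 / qpoch q q ^ 2) UNIV"
proof -
  define E where "E k = qpoch (q ^ k) (q ^ k)" for k
  have nz: "E 1 \<noteq> 0" "E 2 \<noteq> 0" "E 4 \<noteq> 0"
    unfolding E_def by (rule qpoch_self_nonzero[OF q(1)]; simp)+
  have q2: "norm (q\<^sup>2) < 1" "q\<^sup>2 \<noteq> 0" using norm_power_less_1[OF q(1), of 2] q by auto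
  have q3: "norm (q ^ 3) < 1" using norm_power_less_1[OF q(1), of 3] by simp
  have q6: "norm (q ^ 6) < 1" "q ^ 6 \<noteq> 0" using norm_power_less_1[OF q(1), of 6] q by auto
  define \<phi> where "\<phi> = E 2 ^ 5 / (E 1 ^ 2 * E 4 ^ 2)"
  define f where "f m = q powi m\<^sup>2" for m :: int
  define g where "g n = (q\<^sup>2) powi n\<^sup>2 * (- (q\<^sup>2)) powi n" for n :: int
  define T where "T = (\<lambda>(m, n). of_int (m + 2 * n + 1) * (f m * g n))"

  have f: "(f has_sum \<phi>) UNIV"
    unfolding f_def[abs_def] \<phi>_def E_def using theta_squares[OF q] by simp
  have mf: "(\<lambda>m. of_int m * f m) summable_on UNIV"
    using summable_on_theta[OF q(1), of 1 0 1] by (simp add: f_def[abs_def])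
  have g: "(g has_sum 0) UNIV"
    unfolding g_def[abs_def] by (rule theta_vanishing[OF q2])
  have "((\<lambda>n. of_int n * g n) has_sum E 4 ^ 3) UNIV"
    unfolding g_def[abs_def] E_def using jacobi_cube[OF q2] by simp
  from has_sum_add[OF has_sum_cmult_right[OF this, of 2] g]
  have ng: "((\<lambda>n. of_int (2 * n + 1) * g n) has_sum 2 * E 4 ^ 3) UNIV"
    by (simp add: algebra_simps)
  have "((\<lambda>x. (case x of (m, n) \<Rightarrow> of_int m * f m * g n) + (case x of (m, n) \<Rightarrow> f m * (of_int (2 * n + 1) * g n)))
          has_sum infsum (\<lambda>m. of_int m * f m) UNIV * 0 + \<phi> * (2 * E 4 ^ 3)) (UNIV \<times> UNIV)"
    by (intro has_sum_add has_sum_times has_sum_infsum mf f g ng)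
  also have "(\<lambda>x. (case x of (m, n) \<Rightarrow> of_int m * f m * g n) + (case x of (m, n) \<Rightarrow> f m * (of_int (2 * n + 1) * g n))) = T"
    by (auto simp: T_def algebra_simps)
  finally have T: "(T has_sum 2 * \<phi> * E 4 ^ 3) UNIV" by (simp add: mult_ac)

  \<comment> \<open>After the substitution \<open>m = k + r - 2n\<close>, \<open>n \<mapsto> n + k\<close> the term of \<open>T\<close> is \<open>H r k * P r n\<close>: the mixed
      products \<open>k n\<close> in the exponent cancel.\<close>
  define h where "h k = of_int (3 * k + 1) * ((q ^ 3) powi k\<^sup>2 * (- (q\<^sup>2)) powi k)" for k :: int
  define p where "p n = (q ^ 6) powi n\<^sup>2 * (- (q\<^sup>2)) powi n" for n :: int
  define h2 where "h2 k = q ^ 4 * ((3 + 3 * of_int k) * ((q ^ 3) powi k\<^sup>2 * (- (q ^ 6)) powi k))" for k :: int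
  define p2 where "p2 n = (q ^ 6) powi n\<^sup>2 * (- (q ^ 6)) powi n" for n :: int
  define H where "H r = (if r = 0 then h else if r = 1 then (\<lambda>k. h (- k - 1)) else h2)" for r :: int
  define P where "P r = (if r = 0 then p else if r = 1 then (\<lambda>n. p (- n)) else (\<lambda>n. p2 (- n)))" for r :: int
  have "(\<lambda>k. (1 + 3 * of_int k) * ((q ^ 3) powi k\<^sup>2 * (- (q\<^sup>2)) powi k)) summable_on UNIV"
    by (rule summable_on_theta) (use q3 q in auto)
  hence "h summable_on UNIV" by (simp add: h_def[abs_def] add.commute)
  then obtain s where h: "(h has_sum s) UNIV" by (auto simp: summable_on_def)
  have h2: "h2 summable_on UNIV"
    unfolding h2_def[abs_def] by (intro summable_on_cmult_right summable_on_theta) (use q3 q in auto)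
  have p: "(p has_sum E 4) UNIV"
    unfolding p_def[abs_def] E_def by (rule theta_pentagonal[OF q])
  have p2: "(p2 has_sum 0) UNIV"
    unfolding p2_def[abs_def] by (rule theta_vanishing[OF q6])
  have neg: "((\<lambda>n. u (- n)) has_sum c) UNIV" if "(u has_sum c) UNIV" for u :: "int \<Rightarrow> complex" and c
    using that by (subst has_sum_reindex_bij_witness[of _ uminus uminus UNIV u _ c]) auto
  have h_refl: "((\<lambda>k. h (- k - 1)) has_sum s) UNIV"
    using h by (subst has_sum_reindex_bij_witness[of _ "\<lambda>k. - k - 1" "\<lambda>k. - k - 1" UNIV h _ s]) auto

  have T_eq: "T (k + r - 2 * n, n + k) = H r k * P r n" if r: "r \<in> {0, 1, 2}" for r k n
  proof -
    have "T (k + r - 2 * n, n + k) = of_int (3 * k + r + 1) * (-1) powi (n + k) *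
            q powi ((k + r - 2 * n)\<^sup>2 + (2 * (n + k)\<^sup>2 + 2 * (n + k)))"
      using theta_term[OF q(2), of 2 "n + k" 2]
        power_int_add[OF disjI1[OF q(2)], of "(k + r - 2 * n)\<^sup>2" "2 * (n + k)\<^sup>2 + 2 * (n + k)"]
      by (simp add: T_def f_def g_def)
    moreover have sgn: "(-1) powi (- n) = ((-1) powi n :: complex)" for n :: int
      by (simp add: power_int_minus_one_minus)
    note terms = theta_term[OF q(2), of 3 _ 2, unfolded of_nat_numeral]
      theta_term[OF q(2), of 6 _ 2, unfolded of_nat_numeral]
      theta_term[OF q(2), of 3 _ 6, unfolded of_nat_numeral]
      theta_term[OF q(2), of 6 _ 6, unfolded of_nat_numeral]
    have split: "(-1) powi (n + k) = ((-1) powi n * (-1) powi k :: complex)"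
      by (simp add: power_int_add)
    consider "r = 0" | "r = 1" | "r = 2" using r by auto
    hence "H r k * P r n = of_int (3 * k + r + 1) * (-1) powi (n + k) *
            q powi ((k + r - 2 * n)\<^sup>2 + (2 * (n + k)\<^sup>2 + 2 * (n + k)))"
    proof cases
      case 1
      have e: "(k + r - 2 * n)\<^sup>2 + (2 * (n + k)\<^sup>2 + 2 * (n + k)) = (3 * k\<^sup>2 + 2 * k) + (6 * n\<^sup>2 + 2 * n)"
        by (simp add: 1 power2_eq_square algebra_simps)
      have "H r k = of_int (3 * k + r + 1) * ((-1) powi k * q powi (3 * k\<^sup>2 + 2 * k))"
        by (simp add: 1 H_def h_def terms)
      moreover have "P r n = (-1) powi n * q powi (6 * n\<^sup>2 + 2 * n)"
        by (simp add: 1 P_def p_def terms)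
      ultimately show ?thesis
        unfolding e split power_int_add[OF disjI1[OF q(2)], of "3 * k\<^sup>2 + 2 * k"] by simp
    next
      case 2
      have e: "(k + r - 2 * n)\<^sup>2 + (2 * (n + k)\<^sup>2 + 2 * (n + k)) =
              (3 * (- k - 1)\<^sup>2 + 2 * (- k - 1)) + (6 * (- n)\<^sup>2 + 2 * (- n))"
        by (simp add: 2 power2_eq_square algebra_simps)
      have s1: "(-1) powi (- k - 1) = - ((-1) powi k :: complex)"
        using sgn[of "k + 1"] by (simp add: power_int_add)
      have "H r k = of_int (3 * (- k - 1) + 1) * ((-1) powi (- k - 1) * q powi (3 * (- k - 1)\<^sup>2 + 2 * (- k - 1)))"
        by (simp only: H_def h_def terms 2) simp
      also have "of_int (3 * (- k - 1) + 1) = - (of_int (3 * k + r + 1) :: complex)"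
        by (simp add: 2)
      finally have "H r k = of_int (3 * k + r + 1) * ((-1) powi k * q powi (3 * (- k - 1)\<^sup>2 + 2 * (- k - 1)))"
        unfolding s1
        by (simp only: minus_mult_left[symmetric] minus_mult_right[symmetric] minus_minus)
      moreover have "P r n = (-1) powi n * q powi (6 * (- n)\<^sup>2 + 2 * (- n))"
        unfolding P_def p_def terms 2 sgn by simp
      ultimately show ?thesis
        unfolding e split power_int_add[OF disjI1[OF q(2)], of "3 * (- k - 1)\<^sup>2 + 2 * (- k - 1)"] by simp
    next
      case 3
      have e: "(k + r - 2 * n)\<^sup>2 + (2 * (n + k)\<^sup>2 + 2 * (n + k)) =
              4 + (3 * k\<^sup>2 + 6 * k) + (6 * (- n)\<^sup>2 + 6 * (- n))"
        by (simp add: 3 power2_eq_square algebra_simps)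
      have "H r k = q powi 4 * (of_int (3 * k + r + 1) * ((-1) powi k * q powi (3 * k\<^sup>2 + 6 * k)))"
        unfolding H_def h2_def terms 3 by simp
      moreover have "P r n = (-1) powi n * q powi (6 * (- n)\<^sup>2 + 6 * (- n))"
        unfolding P_def p2_def terms 3 sgn by simp
      ultimately show ?thesis
        unfolding e split power_int_add[OF disjI1[OF q(2)], of 4] 
          power_int_add[OF disjI1[OF q(2)], of "4 + (3 * k\<^sup>2 + 6 * k)"] by simp
    qed
    ultimately show ?thesis by simp
  qed

  \<comment> \<open>The substitution is a bijection, since \<open>r\<close> and \<open>k\<close> are remainder and quotient of \<open>m + 2n\<close>
      modulo 3 and then \<open>n\<close> is recovered from the second coordinate.\<close>
  define j :: "int \<times> int \<times> int \<Rightarrow> int \<times> int" where "j = (\<lambda>(r, k, n). (k + r - 2 * n, n + k))"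
  define i :: "int \<times> int \<Rightarrow> int \<times> int \<times> int"
    where "i = (\<lambda>(m, n). ((m + 2 * n) mod 3, (m + 2 * n) div 3, n - (m + 2 * n) div 3))"
  have ij: "i (j a) = a" if "a \<in> {0, 1, 2} \<times> (UNIV \<times> UNIV)" for a
  proof -
    obtain r k n where a: "a = (r, k, n)" "r \<in> {0, 1, 2}" using \<open>a \<in> _\<close> by auto
    have "k + r - 2 * n + 2 * (n + k) = r + k * 3" by simp
    moreover have "(r + k * 3) div 3 = k" "(r + k * 3) mod 3 = r" using a(2) by auto
    ultimately show ?thesis unfolding a i_def j_def by simp
  qed
  have ji: "j (i b) = b" for b
  proof -
    obtain m n where b: "b = (m, n)" by (cases b)
    have "d + r - 2 * (n - d) = m" if "d * 3 + r = m + 2 * n" for d r :: int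
      using that by simp
    from this[OF div_mult_mod_eq] show ?thesis unfolding b i_def j_def by simp
  qed
  have i_range: "i b \<in> {0, 1, 2} \<times> (UNIV \<times> UNIV)" for b
  proof -
    obtain m n where b: "b = (m, n)" by (cases b)
    have "x mod 3 \<in> {0, 1, 2}" for x :: int by auto
    thus ?thesis
      unfolding b i_def by (simp only: prod.case mem_Times_iff fst_conv snd_conv UNIV_I simp_thms)
  qed
  have "((\<lambda>(r, k, n). H r k * P r n) has_sum 2 * \<phi> * E 4 ^ 3) ({0, 1, 2} \<times> (UNIV \<times> UNIV))
          = (T has_sum 2 * \<phi> * E 4 ^ 3) UNIV"
  proof (rule has_sum_reindex_bij_witness[of _ i j])
    fix a :: "int \<times> int \<times> int" assume "a \<in> {0, 1, 2} \<times> (UNIV \<times> UNIV)"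
    thus "T (j a) = (case a of (r, k, n) \<Rightarrow> H r k * P r n)"
      using T_eq unfolding j_def by auto
  qed (rule ij ji i_range refl UNIV_I | assumption)+
  with T have "((\<lambda>(r, k, n). H r k * P r n) has_sum 2 * \<phi> * E 4 ^ 3) ({0, 1, 2} \<times> (UNIV \<times> UNIV))"
    by blast
  moreover have "((\<lambda>x. (\<lambda>(r, k, n). H r k * P r n) (r, x)) has_sum (if r = 2 then 0 else s * E 4)) (UNIV \<times> UNIV)"
    if "r \<in> {0, 1, 2}" for r
  proof -
    consider "r = 0" | "r = 1" | "r = 2" using \<open>r \<in> {0, 1, 2}\<close> by auto
    thus ?thesis
    proof cases
      case 1
      thus ?thesis using has_sum_times[OF h p] by (simp add: H_def P_def)
    next
      case 2
      thus ?thesis using has_sum_times[OF h_refl neg[OF p]] by (simp add: H_def P_def)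
    next
      case 3
      thus ?thesis using has_sum_times[OF has_sum_infsum[OF h2] neg[OF p2]] by (simp add: H_def P_def)
    qed
  qed
  ultimately have "((\<lambda>r. if r = 2 then 0 else s * E 4) has_sum 2 * \<phi> * E 4 ^ 3) {0, 1, 2 :: int}"
    by (rule has_sum_SigmaD)
  hence "2 * \<phi> * E 4 ^ 3 = (\<Sum>r\<in>{0, 1, 2 :: int}. if r = 2 then 0 else s * E 4)"
    by (rule has_sum_unique[OF _ has_sum_finite]) simp
  hence "\<phi> * E 4 ^ 2 = s"
    using nz by (simp add: power2_eq_square power3_eq_cube)
  moreover have "\<phi> * E 4 ^ 2 = E 2 ^ 5 / E 1 ^ 2"
    using nz by (simp add: \<phi>_def)
  ultimately show ?thesis using h by (simp add: h_def[abs_def] E_def)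
qed

section \<open>Folding the integers onto the positive integers prime to 3\<close>

lemma abs_3k_1_cases:
  fixes k :: int
  obtains m where "k \<ge> 0" "k = int m" "nat \<bar>3 * k + 1\<bar> = 3 * m + 1"
    | m where "k < 0" "k = - int m - 1" "nat \<bar>3 * k + 1\<bar> = 3 * m + 2"
proof (cases "k \<ge> 0")
  case True
  show ?thesis by (rule that(1)[of "nat k"]) (use True in auto)
next
  case False
  show ?thesis by (rule that(2)[of "nat (- k - 1)"]) (use False in auto)
qed

lemma has_sum_mod3_reindex:
  fixes F :: "int \<Rightarrow> complex" and G :: "nat \<Rightarrow> complex"
  assumes F: "(F has_sum s) UNIV"
    and GF: "\<And>k. G (nat \<bar>3 * k + 1\<bar>) = F k" and G0: "\<And>m. 3 dvd m \<Longrightarrow> G m = 0"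
  shows "(G has_sum s) UNIV"
proof -
  define i where "i n = (if n mod 3 = 1 then int (n div 3) else - int (n div 3) - 1)" for n :: nat
  have m: "(3 * m + 1) mod 3 = 1" "(3 * m + 1) div 3 = m" "\<not> 3 dvd 3 * m + 1"
    "(3 * m + 2) mod 3 = 2" "(3 * m + 2) div 3 = m" "\<not> 3 dvd 3 * m + 2" for m :: nat
    by presburger+
  have "(F has_sum s) UNIV = (G has_sum s) {n. \<not> 3 dvd n}"
  proof (rule has_sum_reindex_bij_witness[of _ i "\<lambda>k. nat \<bar>3 * k + 1\<bar>"])
    fix k :: int
    show "nat \<bar>3 * k + 1\<bar> \<in> {n. \<not> 3 dvd n}" and "i (nat \<bar>3 * k + 1\<bar>) = k"
    proof -
      show "nat \<bar>3 * k + 1\<bar> \<in> {n. \<not> 3 dvd n}"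
        by (cases k rule: abs_3k_1_cases) (simp_all only: m mem_Collect_eq not_False_eq_True)
      show "i (nat \<bar>3 * k + 1\<bar>) = k"
        by (cases k rule: abs_3k_1_cases) (simp_all only: m i_def, simp_all)
    qed
  next
    fix n :: nat assume "n \<in> {n. \<not> 3 dvd n}"
    hence "\<exists>m. n = 3 * m + 1 \<or> n = 3 * m + 2" by simp presburger
    then obtain l where "n = 3 * l + 1 \<or> n = 3 * l + 2" by blast
    thus "nat \<bar>3 * i n + 1\<bar> = n"
      by (elim disjE) (simp_all only: m i_def, simp_all)
  qed (use GF in auto)
  also have "\<dots> = (G has_sum s) UNIV"
    by (rule has_sum_cong_neutral) (use G0 in auto)
  finally show ?thesis using F by simp
qed

lemma Legendre_3_abs:
  "Legendre (int (nat \<bar>3 * k + 1\<bar>)) 3 = (if k \<ge> 0 then 1 else -1)"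
proof -
  have "nat \<bar>3 * k + 1\<bar> mod 3 = (if k \<ge> 0 then 1 else 2)"
  proof (cases k rule: abs_3k_1_cases)
    case (1 m)
    show ?thesis unfolding 1(3) using 1(1) by presburger
  next
    case (2 m)
    show ?thesis unfolding 2(3) using 2(1) by presburger
  qed
  thus ?thesis unfolding Legendre_3 cong_def by (auto split: if_splits)
qed

lemma Legendre_3_eq_0: "3 dvd m \<Longrightarrow> Legendre (int m) 3 = 0"
  unfolding Legendre_3 cong_def by auto

lemma has_sum_imp_sums_Suc:
  assumes "(f has_sum s) {0<..}"
  shows "(\<lambda>k. f (Suc k)) sums s"
proof -
  have "((\<lambda>k. f (Suc k)) has_sum s) UNIV = (f has_sum s) {0<..}"
    by (rule has_sum_reindex_bij_witness[of _ "\<lambda>n. n - 1" Suc]) auto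
  thus ?thesis using assms has_sum_imp_sums by blast
qed

section \<open>The Lambert series of the character modulo 3\<close>

text \<open>
  For \<open>n = \<bar>3k + 1\<bar>\<close> the term equals \<open>x / (1 - x\<^sup>2)\<close> with \<open>x = q^(3k+1)\<close>, also for negative \<open>k\<close>,
  because \<open>x / (1 - x\<^sup>2)\<close> changes sign under \<open>x \<mapsto> 1/x\<close> just as the character does under \<open>n \<mapsto> -n\<close>.
  The sum over \<open>k\<close> is Kronecker's series to the base \<open>q\<^sup>6\<close>, and the theta products in it are
  quotients of Euler products by splitting into residue classes.
\<close>
lemma lambert_chi3:
  fixes q :: complex
  assumes q: "norm q < 1" "q \<noteq> 0"
  shows "((\<lambda>n. of_int (Legendre (int n) 3) * (q ^ n / (1 - q ^ (2 * n)))) has_sum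
           q * (qpoch q q * qpoch (q ^ 6) (q ^ 6) ^ 6 /
             (qpoch (q\<^sup>2) (q\<^sup>2) ^ 2 * qpoch (q ^ 3) (q ^ 3) ^ 3))) UNIV"
proof -
  define E where "E k = qpoch (q ^ k) (q ^ k)" for k
  have nz: "E 1 \<noteq> 0" "E 2 \<noteq> 0" "E 3 \<noteq> 0" "E 6 \<noteq> 0"
    unfolding E_def by (rule qpoch_self_nonzero[OF q(1)]; simp)+
  have nq: "norm (q ^ k) < 1" if "k > 0" for k using norm_power_less_1[OF q(1) that] .
  have less: "norm (q ^ 6) < norm (q ^ 3)"
    using q by (simp add: norm_power power_strict_decreasing)
  have powi: "q\<^sup>2 * (q ^ 6) powi j = q powi (6 * j + 2)" for j
    using q by (simp add: power_int_add power_int_mult)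
  have ne: "q\<^sup>2 * (q ^ 6) powi j \<noteq> 1" for j
    unfolding powi using q(1) by (intro power_int_neq_1) presburger+
  note K = kronecker_lambert_series[OF _ less nq[of 3] _ ne]

  have odd1: "qpoch q (q\<^sup>2) = E 1 / E 2"
    using qpoch_odd[OF q(1)] by (simp add: E_def)
  have odd3: "qpoch (q ^ 3) (q ^ 6) = E 3 / E 6"
    using qpoch_odd[OF nq[of 3]] by (simp add: E_def power_mult[symmetric])
  have "qpoch q (q\<^sup>2) = qpoch q (q ^ 6) * qpoch (q ^ 3) (q ^ 6) * qpoch (q ^ 5) (q ^ 6)"
    using qpoch_mod3[OF nq[of 2], of q]
    by (simp add: power_mult[symmetric] power_Suc[symmetric] del: power_Suc)
  hence zw: "qpoch (q ^ 5) (q ^ 6) * qpoch q (q ^ 6) = (E 1 / E 2) / (E 3 / E 6)"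
    using nz unfolding odd1 odd3 by (simp add: field_simps)
  have "E 2 = qpoch (q\<^sup>2) (q ^ 6) * qpoch (q ^ 4) (q ^ 6) * E 6"
    unfolding E_def using qpoch_mod3[OF nq[of 2], of "q\<^sup>2"]
    by (simp add: power_mult[symmetric] power_add[symmetric])
  hence w: "qpoch (q\<^sup>2) (q ^ 6) * qpoch (q ^ 4) (q ^ 6) = E 2 / E 6"
    using nz by (simp add: field_simps)
  have pows: "q ^ 3 * q\<^sup>2 = q ^ 5" "q ^ 6 / q ^ 5 = q" "q ^ 6 / q ^ 3 = q ^ 3" "q ^ 6 / q\<^sup>2 = q ^ 4"
    using q by (simp_all add: power_add[symmetric] field_simps power_Suc[symmetric] del: power_Suc)
  have "((\<lambda>j::int. (q ^ 3) powi j / (1 - q\<^sup>2 * (q ^ 6) powi j)) has_sum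
      (E 6)\<^sup>2 * ((E 1 / E 2) / (E 3 / E 6)) / ((E 3 / E 6) * (E 3 / E 6) * (E 2 / E 6))) UNIV"
    using K q unfolding pows zw w odd3 by (simp add: E_def)
  also have "(E 6)\<^sup>2 * ((E 1 / E 2) / (E 3 / E 6)) / ((E 3 / E 6) * (E 3 / E 6) * (E 2 / E 6))
      = E 1 * E 6 ^ 6 / (E 2 ^ 2 * E 3 ^ 3)"
    using nz by (simp add: field_simps eval_nat_numeral)
  finally have *: "((\<lambda>j::int. q * ((q ^ 3) powi j / (1 - q\<^sup>2 * (q ^ 6) powi j))) has_sum
      q * (E 1 * E 6 ^ 6 / (E 2 ^ 2 * E 3 ^ 3))) UNIV"
    by (rule has_sum_cmult_right)
  have "((\<lambda>n. of_int (Legendre (int n) 3) * (q ^ n / (1 - q ^ (2 * n)))) has_sum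
      q * (E 1 * E 6 ^ 6 / (E 2 ^ 2 * E 3 ^ 3))) UNIV"
  proof (rule has_sum_mod3_reindex[OF *])
    fix k :: int
    have lhs: "q * ((q ^ 3) powi k / (1 - q\<^sup>2 * (q ^ 6) powi k)) = q powi (3 * k + 1) / (1 - q powi (2 * (3 * k + 1)))"
    proof -
      have "q * (q ^ 3) powi k = q powi (3 * k + 1)"
        using q by (simp add: power_int_mult power_int_add)
      moreover have "2 * (3 * k + 1) = 6 * k + 2" by simp
      ultimately show ?thesis unfolding powi by (metis times_divide_eq_right)
    qed
    show "of_int (Legendre (int (nat \<bar>3 * k + 1\<bar>)) 3) * (q ^ nat \<bar>3 * k + 1\<bar> / (1 - q ^ (2 * nat \<bar>3 * k + 1\<bar>)))
        = q * ((q ^ 3) powi k / (1 - q\<^sup>2 * (q ^ 6) powi k))"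
    proof (cases "k \<ge> 0")
      case True
      define n where "n = nat \<bar>3 * k + 1\<bar>"
      have L: "Legendre (int n) 3 = 1" unfolding n_def Legendre_3_abs using True by simp
      have "3 * k + 1 = int n" using True by (simp add: n_def)
      moreover have "q powi (2 * int n) = q ^ (2 * n)" by (metis of_nat_mult of_nat_numeral power_int_of_nat)
      ultimately show ?thesis
        unfolding lhs n_def[symmetric] L by simp
    next
      case False
      define n where "n = nat \<bar>3 * k + 1\<bar>"
      have L: "Legendre (int n) 3 = -1" unfolding n_def Legendre_3_abs using False by simp
      have e: "3 * k + 1 = - int n" using False by (simp add: n_def)
      have "q powi (2 * - int n) = 1 / q ^ (2 * n)"
        by (metis inverse_eq_divide mult_minus_right of_nat_mult of_nat_numeral power_int_minus power_int_of_nat)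
      moreover have "q powi (- int n) = 1 / q ^ n" by (simp add: power_int_minus inverse_eq_divide)
      moreover have "1 / x / (1 - 1 / (x * x)) = - (x / (1 - x * x))" if "x \<noteq> 0" for x :: complex
        using that by (simp add: divide_simps) (auto simp: algebra_simps)
      moreover have "q ^ (2 * n) = q ^ n * q ^ n" by (simp add: mult_2 power_add)
      ultimately show ?thesis
        unfolding lhs n_def[symmetric] unfolding e L using q by simp
    qed
  qed (simp add: Legendre_3_eq_0)
  thus ?thesis by (simp add: E_def)
qed

lemma sum_Legendre_3_dstar:
  assumes "n > 0"
  shows "(\<Sum>d | d dvd n \<and> odd (n div d). Legendre (int d) 3) = int (dstar 1 3 n) - int (dstar 2 3 n)"
proof -
  let ?D = "{d. d dvd n \<and> odd (n div d)}"
  have fin: "finite ?D" using finite_divisors_nat[of n] assms by (auto intro: finite_subset)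
  have pos: "d > 0" if "d dvd n" for d using that assms dvd_pos_nat by blast
  have D: "dstar j 3 n = card {d \<in> ?D. [d = j] (mod 3)}" for j
    unfolding dstar_def by (rule arg_cong[of _ _ card]) (use pos in auto)
  have "(\<Sum>d\<in>?D. Legendre (int d) 3) =
      (\<Sum>d\<in>?D. (if [d = 1] (mod 3) then 1 else 0) - (if [d = 2] (mod 3) then 1 else 0))"
    by (intro sum.cong refl) (auto simp: Legendre_3 cong_def)
  also have "\<dots> = int (dstar 1 3 n) - int (dstar 2 3 n)"
    unfolding D sum_subtractf using fin by (simp add: sum.If_cases Int_def conj_commute)
  finally show ?thesis .
qed

text \<open>
  Expansion of \<open>q\<^sup>n / (1 - q\<^sup>2\<^sup>n)\<close> gives the powers \<open>q^(n (2m + 1))\<close>; the exponents \<open>N = n (2m + 1)\<close> that occur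
  correspond to the divisors \<open>n\<close> of \<open>N\<close> with odd cofactor. The rearrangement is justified by
  \<open>n (2m + 1) \<ge> n + m\<close>, which bounds the double series by a product of two geometric series.
\<close>
lemma lambert_regroup:
  fixes q :: complex
  assumes q: "norm q < 1"
    and s: "((\<lambda>n. of_int (Legendre (int n) 3) * (q ^ n / (1 - q ^ (2 * n)))) has_sum s) UNIV"
  shows "((\<lambda>n. (of_nat (dstar 1 3 n) - of_nat (dstar 2 3 n)) * q ^ n) has_sum s) {0<..}"
proof -
  define \<psi> where "\<psi> n = (of_int (Legendre (int n) 3) :: complex)" for n
  define D where "D n = {d. d dvd n \<and> odd (n div d)}" for n :: nat
  have chi: "norm (\<psi> n) \<le> 1" for n by (simp add: \<psi>_def Legendre_3)
  have geo: "((\<lambda>m. x ^ m) has_sum 1 / (1 - x)) UNIV" if "norm x < 1" for x :: complex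
    using that geometric_sums[OF that]
    by (intro norm_summable_imp_has_sum) (auto simp: norm_power intro: summable_geometric)
  have inner: "((\<lambda>m. \<psi> n * q ^ (n * (2 * m + 1))) has_sum \<psi> n * (q ^ n / (1 - q ^ (2 * n)))) UNIV"
    if "n > 0" for n
  proof -
    have "norm (q ^ (2 * n)) < 1" using that by (intro norm_power_less_1 q) auto
    from has_sum_cmult_right[OF geo[OF this], of "\<psi> n * q ^ n"] show ?thesis
      by (simp add: power_add power_mult[symmetric] algebra_simps)
  qed
  have "((\<lambda>(n, m). q ^ n * q ^ m) has_sum (1 / (1 - q)) * (1 / (1 - q))) (UNIV \<times> UNIV)"
    by (intro has_sum_times geo q)
  hence "(\<lambda>x. norm (case x of (n, m) \<Rightarrow> q ^ n * q ^ m)) summable_on (UNIV \<times> UNIV)"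
    using has_sum_imp_summable summable_on_iff_abs_summable_on_complex by blast
  hence "(\<lambda>x. norm (case x of (n, m) \<Rightarrow> q ^ n * q ^ m)) summable_on ({0<..} \<times> UNIV)"
    by (rule summable_on_subset) auto
  hence "(\<lambda>x. norm (case x of (n, m) \<Rightarrow> \<psi> n * q ^ (n * (2 * m + 1)))) summable_on ({0<..} \<times> (UNIV :: nat set))"
  proof (rule Infinite_Sum.abs_summable_on_comparison_test')
    fix x :: "nat \<times> nat" assume "x \<in> {0<..} \<times> UNIV"
    then obtain n m where x: "x = (n, m)" "n > 0" by auto
    have "n + m \<le> n * (2 * m + 1)"
    proof -
      have "m * 1 \<le> m * n" using x by (intro mult_left_mono) auto
      thus ?thesis by (simp add: algebra_simps)
    qed
    hence "norm q ^ (n * (2 * m + 1)) \<le> norm q ^ (n + m)"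
      using q by (intro power_decreasing) auto
    hence "norm (\<psi> n) * norm q ^ (n * (2 * m + 1)) \<le> 1 * norm q ^ (n + m)"
      using chi by (intro mult_mono) auto
    thus "norm (case x of (n, m) \<Rightarrow> \<psi> n * q ^ (n * (2 * m + 1))) \<le> norm (case x of (n, m) \<Rightarrow> q ^ n * q ^ m)"
      by (simp only: x prod.case norm_mult norm_power power_add mult_1)
  qed
  hence summable: "(\<lambda>(n, m). \<psi> n * q ^ (n * (2 * m + 1))) summable_on ({0<..} \<times> (UNIV :: nat set))"
    by (rule abs_summable_summable)
  have "((\<lambda>n. \<psi> n * (q ^ n / (1 - q ^ (2 * n)))) has_sum s) UNIV =
        ((\<lambda>n. \<psi> n * (q ^ n / (1 - q ^ (2 * n)))) has_sum s) {0<..}"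
    by (rule has_sum_cong_neutral) (auto simp: \<psi>_def Legendre_3_eq_0)
  with s have "((\<lambda>n. \<psi> n * (q ^ n / (1 - q ^ (2 * n)))) has_sum s) {0<..}"
    by (simp add: \<psi>_def)
  hence "((\<lambda>(n, m). \<psi> n * q ^ (n * (2 * m + 1))) has_sum s) ({0<..} \<times> (UNIV :: nat set))"
    using inner summable by (intro has_sum_SigmaI) auto
  also have "((\<lambda>(n, m). \<psi> n * q ^ (n * (2 * m + 1))) has_sum s) ({0<..} \<times> (UNIV :: nat set)) =
      ((\<lambda>(N, d). \<psi> d * q ^ N) has_sum s) (Sigma {0<..} D)"
  proof (rule has_sum_reindex_bij_witness[of _ "\<lambda>(N, d). (d, N div d div 2)" "\<lambda>(n, m). (n * (2 * m + 1), n)"])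
    fix b :: "nat \<times> nat" assume "b \<in> Sigma {0<..} D"
    then obtain N d where b: "b = (N, d)" "N > 0" "d dvd N" "odd (N div d)" by (auto simp: D_def)
    from b(3) obtain c where c: "N = d * c" by blast
    with b have d: "d > 0" and "odd c" by auto
    then obtain m where m: "c = 2 * m + 1" by (elim oddE)
    show "(\<lambda>(n, m). (n * (2 * m + 1), n)) ((\<lambda>(N, d). (d, N div d div 2)) b) = b"
      using d unfolding b c m by simp
    show "(\<lambda>(N, d). (d, N div d div 2)) b \<in> {0<..} \<times> (UNIV :: nat set)"
      using d unfolding b by simp
  qed (auto simp: D_def)
  finally have "((\<lambda>(N, d). \<psi> d * q ^ N) has_sum s) (Sigma {0<..} D)" .
  hence "((\<lambda>N. \<Sum>d\<in>D N. \<psi> d * q ^ N) has_sum s) {0<..}"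
  proof (rule has_sum_SigmaD)
    fix N :: nat assume "N \<in> {0<..}"
    hence "finite (D N)"
      using finite_divisors_nat[of N] unfolding D_def by (auto intro: finite_subset)
    thus "((\<lambda>d. (\<lambda>(N, d). \<psi> d * q ^ N) (N, d)) has_sum (\<Sum>d\<in>D N. \<psi> d * q ^ N)) (D N)"
      by simp
  qed
  also have "?this \<longleftrightarrow> ?thesis"
  proof (rule has_sum_cong)
    fix N :: nat assume "N \<in> {0<..}"
    hence "(of_int (\<Sum>d\<in>D N. Legendre (int d) 3) :: complex) = of_nat (dstar 1 3 N) - of_nat (dstar 2 3 N)"
      unfolding D_def by (subst sum_Legendre_3_dstar) auto
    thus "(\<Sum>d\<in>D N. \<psi> d * q ^ N) = (of_nat (dstar 1 3 N) - of_nat (dstar 2 3 N)) * q ^ N"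
      by (simp add: \<psi>_def sum_distrib_right[symmetric])
  qed
  finally show ?thesis .
qed

section \<open>Eta quotients\<close>

lemma dedekind_eta_eq_qpoch:
  "dedekind_eta (of_nat k * \<tau>) =
     exp (2 * of_real pi * \<i> * \<tau> / 24) ^ k * qpoch (q_param \<tau> ^ k) (q_param \<tau> ^ k)"
proof -
  have "q_param (of_nat k * \<tau>) = q_param \<tau> ^ k"
    unfolding q_param_def exp_of_nat_mult[symmetric] by (simp add: mult_ac)
  moreover have "exp (2 * of_real pi * \<i> * (of_nat k * \<tau>) / 24) = exp (2 * of_real pi * \<i> * \<tau> / 24) ^ k"
    unfolding exp_of_nat_mult[symmetric] by (simp add: mult_ac)
  ultimately show ?thesis
    by (simp only: dedekind_eta_def qpoch_def power_Suc)
qed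

theorem corollary5p2:
  fixes \<tau> q :: complex
  assumes "Im \<tau> > 0" and "q = exp (2 * of_real pi * \<i> * \<tau>)"
  shows "(\<lambda>k. let n = Suc k in
            (-1) ^ (n - 1) * of_nat n * of_int (Legendre (int n) 3)
              * exp (2 * of_real pi * \<i> * of_nat n ^ 2 * \<tau> / 3))
          sums (dedekind_eta (2 * \<tau>) ^ 5 / dedekind_eta \<tau> ^ 2) \<and>
         (\<lambda>k. let n = Suc k in
            (of_nat (dstar 1 3 n) - of_nat (dstar 2 3 n)) * q ^ n)
          sums (dedekind_eta \<tau> * dedekind_eta (6 * \<tau>) ^ 6
                / (dedekind_eta (2 * \<tau>) ^ 2 * dedekind_eta (3 * \<tau>) ^ 3))"
proof
  have q: "norm q < 1" "q \<noteq> 0"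
    using norm_q_param_less_1[OF assms(1)] by (simp_all add: assms(2) q_param_def)
  \<comment> \<open>\<open>x\<close> and \<open>Q = x\<^sup>8\<close> stand for the fractional powers of \<open>q\<close> with exponents 1/24 and 1/3\<close>
  define x where "x = exp (2 * of_real pi * \<i> * \<tau> / 24)"
  have x: "x \<noteq> 0" by (simp add: x_def)
  have x24: "x ^ 24 = q"
    unfolding x_def assms(2) exp_of_nat_mult[symmetric] by (simp add: mult_ac)
  define E where "E k = qpoch (q ^ k) (q ^ k)" for k
  have eta: "dedekind_eta (of_nat k * \<tau>) = x ^ k * E k" for k
    unfolding dedekind_eta_eq_qpoch by (simp add: x_def E_def assms(2) q_param_def)
  have etas: "dedekind_eta \<tau> = x * E 1" "dedekind_eta (2 * \<tau>) = x ^ 2 * E 2"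
    "dedekind_eta (3 * \<tau>) = x ^ 3 * E 3" "dedekind_eta (6 * \<tau>) = x ^ 6 * E 6"
    using eta[of 1] eta[of 2] eta[of 3] eta[of 6] by simp_all

  define Q where "Q = x ^ 8"
  have Q: "Q \<noteq> 0" "Q ^ 3 = q" using x by (simp_all add: Q_def x24[symmetric] power_mult[symmetric])
  have expQ: "exp (2 * of_real pi * \<i> * of_nat n ^ 2 * \<tau> / 3) = Q ^ n\<^sup>2" for n
    unfolding Q_def x_def exp_of_nat_mult[symmetric] by (simp add: mult_ac)
  let ?G = "\<lambda>n::nat. (-1) ^ (n - 1) * of_nat n * of_int (Legendre (int n) 3) * Q ^ n\<^sup>2 :: complex"
  have "((\<lambda>k. Q * (of_int (3 * k + 1) * ((q ^ 3) powi k\<^sup>2 * (- (q\<^sup>2)) powi k))) has_sum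
           Q * (qpoch (q\<^sup>2) (q\<^sup>2) ^ 5 / qpoch q q ^ 2)) UNIV"
    by (rule has_sum_cmult_right[OF weight_three_halves_theta[OF q]])
  hence "(?G has_sum Q * (qpoch (q\<^sup>2) (q\<^sup>2) ^ 5 / qpoch q q ^ 2)) UNIV"
  proof (rule has_sum_mod3_reindex)
    fix k :: int
    define n where "n = nat \<bar>3 * k + 1\<bar>"
    have "Q * (q powi (3 * k\<^sup>2 + 2 * k)) = Q powi (3 * k + 1)\<^sup>2"
    proof -
      have "(3 * k + 1)\<^sup>2 = 1 + 3 * (3 * k\<^sup>2 + 2 * k)" by (simp add: power2_eq_square algebra_simps)
      moreover have "q powi (3 * k\<^sup>2 + 2 * k) = Q powi (3 * (3 * k\<^sup>2 + 2 * k))"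
        unfolding Q(2)[symmetric] by (subst power_int_mult) simp
      ultimately show ?thesis using Q by (simp only: power_int_add simp_thms power_int_1_right)
    qed
    also have "(3 * k + 1)\<^sup>2 = (int n)\<^sup>2" by (simp add: n_def)
    also have "Q powi (int n)\<^sup>2 = Q ^ n\<^sup>2" by (metis of_nat_power power_int_of_nat)
    finally have A: "Q * (q powi (3 * k\<^sup>2 + 2 * k)) = Q ^ n\<^sup>2" .
    have B: "(-1) ^ (n - 1) * of_nat n * of_int (Legendre (int n) 3) = (of_int (3 * k + 1) * (-1) powi k :: complex)"
    proof (cases k rule: abs_3k_1_cases)
      case (1 m)
      have n: "n = 3 * m + 1" by (simp only: n_def 1(3))
      have L: "Legendre (int n) 3 = 1" unfolding n_def Legendre_3_abs using 1 by simp
      show ?thesis unfolding L unfolding n 1(2) by (simp add: minus_one_power_iff)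
    next
      case (2 m)
      have n: "n = 3 * m + 2" by (simp only: n_def 2(3))
      have L: "Legendre (int n) 3 = -1" unfolding n_def Legendre_3_abs using 2 by simp
      have "k = - int (Suc m)" by (simp add: 2)
      hence s: "(-1) powi k = ((-1) ^ Suc m :: complex)"
        by (simp only: power_int_minus_one_minus power_int_of_nat)
      show ?thesis unfolding L s unfolding n 2(2) by (simp add: minus_one_power_iff algebra_simps)
    qed
    show "?G (nat \<bar>3 * k + 1\<bar>) = Q * (of_int (3 * k + 1) * ((q ^ 3) powi k\<^sup>2 * (- (q\<^sup>2)) powi k))"
      unfolding n_def[symmetric] B A[symmetric] theta_term[OF q(2), unfolded of_nat_numeral]
      by (simp add: mult_ac)
  qed (simp add: Legendre_3_eq_0)
  also have "(?G has_sum Q * (qpoch (q\<^sup>2) (q\<^sup>2) ^ 5 / qpoch q q ^ 2)) UNIV =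
     (?G has_sum Q * (qpoch (q\<^sup>2) (q\<^sup>2) ^ 5 / qpoch q q ^ 2)) {0<..}"
    by (rule has_sum_cong_neutral) auto
  finally have "(\<lambda>k. ?G (Suc k)) sums (Q * (qpoch (q\<^sup>2) (q\<^sup>2) ^ 5 / qpoch q q ^ 2))"
    by (rule has_sum_imp_sums_Suc)
  moreover have "dedekind_eta (2 * \<tau>) ^ 5 / dedekind_eta \<tau> ^ 2 = Q * (qpoch (q\<^sup>2) (q\<^sup>2) ^ 5 / qpoch q q ^ 2)"
    unfolding etas Q_def using x by (simp add: E_def power_mult_distrib power_mult[symmetric] divide_simps power_add[symmetric])
  ultimately show "(\<lambda>k. let n = Suc k in
            (-1) ^ (n - 1) * of_nat n * of_int (Legendre (int n) 3)
              * exp (2 * of_real pi * \<i> * of_nat n ^ 2 * \<tau> / 3))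
          sums (dedekind_eta (2 * \<tau>) ^ 5 / dedekind_eta \<tau> ^ 2)"
    unfolding Let_def expQ by simp

  have "(\<lambda>k. (of_nat (dstar 1 3 (Suc k)) - of_nat (dstar 2 3 (Suc k))) * q ^ Suc k) sums
     (q * (qpoch q q * qpoch (q ^ 6) (q ^ 6) ^ 6 / (qpoch (q\<^sup>2) (q\<^sup>2) ^ 2 * qpoch (q ^ 3) (q ^ 3) ^ 3)))"
    by (rule has_sum_imp_sums_Suc[OF lambert_regroup[OF q(1) lambert_chi3[OF q]]])
  moreover have "dedekind_eta \<tau> * dedekind_eta (6 * \<tau>) ^ 6
                / (dedekind_eta (2 * \<tau>) ^ 2 * dedekind_eta (3 * \<tau>) ^ 3) =
     q * (qpoch q q * qpoch (q ^ 6) (q ^ 6) ^ 6 / (qpoch (q\<^sup>2) (q\<^sup>2) ^ 2 * qpoch (q ^ 3) (q ^ 3) ^ 3))"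
  proof -
    have "x * x ^ 36 = q * x ^ 13"
      unfolding x24[symmetric] by (simp only: power_add[symmetric] power_Suc[symmetric]) simp
    thus ?thesis
      unfolding etas using x
      by (simp add: E_def power_mult_distrib power_mult[symmetric] divide_simps power_add[symmetric])
  qed
  ultimately show "(\<lambda>k. let n = Suc k in
            (of_nat (dstar 1 3 n) - of_nat (dstar 2 3 n)) * q ^ n)
          sums (dedekind_eta \<tau> * dedekind_eta (6 * \<tau>) ^ 6
                / (dedekind_eta (2 * \<tau>) ^ 2 * dedekind_eta (3 * \<tau>) ^ 3))"
    unfolding Let_def by simp
qed

end
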